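(* Let $n \ge 5$ be an integer and let $p$ and $q$ be primes with $p \le q \le n$. Then the alternating group $\mathrm{Alt}_n$ can be generated by a Sylow $p$-subgroup and a Sylow $q$-subgroup; that is, there exist a Sylow $p$-subgroup $P$ and a Sylow $q$-subgroup $Q$ of $\mathrm{Alt}_n$ with $\mathrm{Alt}_n = \langle P, Q\rangle$.
   Context: $\mathrm{Alt}_n$ denotes the alternating group of degree $n$. *)

theory Defs
  imports "HOL-Computational_Algebra.Primes" "HOL-Algebra.Sym_Groups"
begin

text \<open>
  Sylow \<open>p\<close>-subgroups of a finite group, for prime \<open>p\<close>: subgroups whose order is the full power
  of \<open>p\<close> dividing the group order. Finiteness is required explicitly because \<^const>\<open>order\<close> is
  \<open>0\<close> for infinite groups, where the cardinality condition would be meaningless.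
\<close>

definition sylow_subgroup :: "nat \<Rightarrow> 'a set \<Rightarrow> ('a, 'b) monoid_scheme \<Rightarrow> bool"
  where "sylow_subgroup p H G \<longleftrightarrow>
    finite (carrier G) \<and> subgroup H G \<and> card H = p ^ multiplicity p (order G)"

end

theory Submission
  imports Defs "HOL-Algebra.Group_Action" "HOL-Algebra.Sylow" "HOL-Algebra.Multiplicative_Group"
    "HOL-Number_Theory.Cong"
begin

text \<open>
  By Sylow's theorems it suffices to find a \<open>p\<close>-group and a \<open>q\<close>-group of permutations whose even
  elements generate \<open>Alt\<^sub>n\<close>. The largest sets on which a permutation group contains every 3-cycle
  behave like blocks of imprimitivity, and such a block absorbs every cycle of prime length in the
  group whose support meets it. Hence one 3-cycle in a well chosen pair of groups is enough as long
  as the disjoint \<open>p\<close>-cycles of the first group and the disjoint \<open>q\<close>-cycles of the second one are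
  linked into a connected configuration, and such configurations are grown point by point from
  small ones.

  The initial 3-cycle is a commutator of a \<open>p\<close>-cycle and a \<open>q\<close>-cycle that share one point or whose
  supports are nested. If \<open>n < 2p\<close>, the two cycles may be forced to overlap in between; then the
  commutator is a double transposition \<open>d\<close>, and \<open>(d d')\<^sup>2\<close> is a 3-cycle for a suitable conjugate
  \<open>d'\<close>, apart from six triples \<open>(p, q, n)\<close> with \<open>q \<le> 7\<close> that are treated explicitly. For \<open>p = 2\<close>
  one uses dihedral groups of order 8, whose Klein four-groups move into each other.
\<close>

section \<open>Subgroups of prime power order lie in Sylow subgroups\<close>

text \<open>Sylow subgroups of \<open>alt_group n\<close> are never described. Only small groups of
  permutations are constructed, and any Sylow subgroups containing their even elements will do. For
  the same reason generation is tested against an arbitrary group \<open>H\<close> that contains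
  these elements. The case distinction for odd primes comes from the lack of room. One
  \<open>p\<close>-cycle and one \<open>q\<close>-cycle that meet in a point occupy
  \<open>p + q - 1\<close> points. If \<open>n\<close> is smaller, the overlap must grow. For
  \<open>p < q\<close> and \<open>2 * p \<le> n\<close> the supports can be nested, and a second
  \<open>p\<close>-cycle covers the remaining points. For \<open>q < n < 2 * p\<close> there is room
  for only one cycle of each kind, so covering all points forces them to share exactly
  \<open>m = p + q - n\<close> points. The six exceptional triples arise there: a shift by
  \<open>i\<close> of the double transposition \<open>d\<close> along the \<open>q\<close>-cycle
  should share only one point with \<open>d\<close>, and no such \<open>i\<close> exists for
  \<open>q = 5\<close>, nor for \<open>q = 7\<close> with \<open>m = 3\<close> or
  \<open>m = 5\<close>.\<close>

lemma (in group) card_p_subgroup: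
  assumes "finite (carrier G)" and "prime p" and H: "subgroup H G"
    and exps: "\<And>x. x \<in> H \<Longrightarrow> \<exists>k::nat. x [^] (p ^ k) = \<one>"
  shows "\<exists>k. card H = p ^ k"
proof -
  let ?K = "G\<lparr>carrier := H\<rparr>"
  have K: "group ?K" using H by (rule subgroup_imp_group)
  have finH: "finite H" using H assms(1) finite_subset subgroup.subset by blast
  have oK: "order ?K = card H" by (simp add: order_def)
  have pos: "card H \<noteq> 0" using subgroup.finite_imp_card_positive[OF H assms(1)] by simp
  have "r = p" if r: "prime r" "r dvd card H" for r
  proof -
    \<comment> \<open>With exponent 1 Sylow's theorem is Cauchy's theorem. A nontrivial element of
      the resulting subgroup has order \<open>r\<close>, and this order divides a power of
      \<open>p\<close>.\<close>
    obtain m where "order ?K = r ^ 1 * m" using r(2) oK by auto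
    from sylow_thm[OF r(1) K this] finH obtain R where R: "subgroup R ?K" "card R = r" by auto
    have RH: "R \<subseteq> H" using subgroup.subset[OF R(1)] by simp
    have R': "subgroup R G" using R(1) H incl_subgroup by blast
    have gR: "group (G\<lparr>carrier := R\<rparr>)" using R' by (rule subgroup_imp_group)
    have "r > 1" using r(1) prime_gt_1_nat by blast
    then have "R \<noteq> {\<one>}" using R(2) by auto
    moreover have "\<one> \<in> R" using R' subgroup.one_closed by blast
    ultimately obtain x where x: "x \<in> R" "x \<noteq> \<one>" by auto
    have xG: "x \<in> carrier G" using x R' subgroup.mem_carrier by metis
    have ord_r: "ord x dvd r"
    proof -
      have "x [^]\<^bsub>G\<lparr>carrier := R\<rparr>\<^esub> order (G\<lparr>carrier := R\<rparr>) = \<one>\<^bsub>G\<lparr>carrier := R\<rparr>\<^esub>"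
        using x finH RH by (intro group.pow_order_eq_1[OF gR]) (auto simp: finite_subset)
      then have "x [^] r = \<one>" using R(2) by (simp add: order_def nat_pow_consistent[symmetric])
      then show ?thesis using pow_eq_id xG by blast
    qed
    obtain k where "x [^] (p ^ k) = \<one>" using exps x RH by blast
    then have "ord x dvd p ^ k" using pow_eq_id xG by blast
    moreover have "ord x \<noteq> 1" using ord_eq_1 xG x(2) by simp
    moreover have "ord x = r" using ord_r r(1) calculation(2) by (metis prime_nat_iff)
    ultimately have "r dvd p" using r(1) prime_dvd_power by blast
    then show ?thesis using r(1) assms(2) primes_dvd_imp_eq by blast
  qed
  then have "prime_factors (card H) \<subseteq> {p}"
    by (auto simp: prime_factors_dvd)
  then have "card H = p ^ multiplicity p (card H)"
  proof -
    have "card H = (\<Prod>q\<in>prime_factors (card H). q ^ multiplicity q (card H))"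
      using pos prime_factorization_nat by blast
    also have "\<dots> = (\<Prod>q\<in>{p}. q ^ multiplicity q (card H))"
      using \<open>prime_factors (card H) \<subseteq> {p}\<close>
      by (intro prod.mono_neutral_left)
         (auto simp: prime_factors_multiplicity assms(2))
    finally show ?thesis by simp
  qed
  then show ?thesis by blast
qed

text \<open>Right multiplication on the cosets \<open>T #> x\<close> reverses the order of products;
  the inverse turns it into a left action.\<close>

lemma (in group) coset_action:
  assumes T: "subgroup T G"
  shows "group_action G (rcosets T) (\<lambda>g. \<lambda>C\<in>rcosets T. C #> inv g)"
proof -
  let ?E = "rcosets T"
  let ?f = "\<lambda>g. \<lambda>C\<in>?E. C #> inv g"
  have TG: "T \<subseteq> carrier G" using T subgroup.subset by blast
  have EG: "C \<subseteq> carrier G" if "C \<in> ?E" for C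
    using that T is_group subgroup.rcosets_carrier by blast
  have closed: "C #> g \<in> ?E" if "C \<in> ?E" "g \<in> carrier G" for C g
    using that TG by (auto simp: RCOSETS_def coset_mult_assoc)
  have bij: "?f g \<in> Bij ?E" if g: "g \<in> carrier G" for g
  proof -
    have "bij_betw (?f g) ?E ?E"
      using g closed EG
      by (intro bij_betw_byWitness[where f' = "\<lambda>C. C #> g"])
         (auto simp: coset_mult_assoc)
    then show ?thesis by (simp add: Bij_def)
  qed
  have "?f (g \<otimes> h) = compose ?E (?f g) (?f h)" if "g \<in> carrier G" "h \<in> carrier G" for g h
    using that closed EG
    by (intro ext) (auto simp: compose_def restrict_def coset_mult_assoc inv_mult_group)
  then have "?f \<in> hom G (BijGroup ?E)"
    using bij by (auto simp: hom_def BijGroup_def)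
  then show ?thesis
    unfolding group_action_def group_hom_def group_hom_axioms_def
    using is_group group_BijGroup by blast
qed

text \<open>\<open>H\<close> permutes the cosets of a Sylow subgroup \<open>T\<close>. Their number
  is prime to \<open>p\<close>, while every orbit has \<open>p\<close>-power size, so some coset
  \<open>T #> g\<close> is fixed; this puts \<open>H\<close> into the conjugate of \<open>T\<close>
  by \<open>g\<close>.\<close>

lemma (in group) p_subgroup_subset_sylow:
  assumes fin: "finite (carrier G)" and p: "prime p" and H: "subgroup H G"
    and exps: "\<And>x. x \<in> H \<Longrightarrow> \<exists>k::nat. x [^] (p ^ k) = \<one>"
  shows "\<exists>S. H \<subseteq> S \<and> sylow_subgroup p S G"
proof -
  have pos: "order G > 0" using fin order_gt_0_iff_finite by blast
  define a where "a = multiplicity p (order G)"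
  obtain m where m: "order G = p ^ a * m" "\<not> p dvd m"
    using multiplicity_decompose'[of "order G" p] pos p unfolding a_def
    by (metis not_prime_unit less_not_refl)
  obtain T where T: "subgroup T G" "card T = p ^ a"
    using sylow_thm[OF p is_group m(1) fin] by blast
  let ?E = "rcosets T"
  let ?f = "\<lambda>g. \<lambda>C\<in>?E. C #> inv g"
  let ?K = "G\<lparr>carrier := H\<rparr>"
  have "p > 0" using p prime_gt_0_nat by blast
  then have cardE: "card ?E = m"
    using lagrange[OF T(1)] m(1) T(2) by (auto simp: mult.commute)
  have finE: "finite ?E" using fin rcosets_finite
    by (metis T(1) rcosets_part_G finite_UnionD)
  interpret act: group_action ?K ?E ?f
    using group_action.induced_action[OF coset_action[OF T(1)] H] .
  obtain k where k: "card H = p ^ k" using card_p_subgroup[OF fin p H exps] by blast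
  have orb: "card (orbit ?K ?f C) dvd p ^ k" if "C \<in> ?E" for C
    using act.orbit_stabilizer_theorem[OF that] k by (simp add: order_def) (metis dvd_triv_left)
  have "\<exists>C\<in>?E. card (orbit ?K ?f C) = 1"
  proof (rule ccontr)
    assume neg: "\<not> ?thesis"
    have pd: "p dvd card (orbit ?K ?f C)" if C: "C \<in> ?E" for C
    proof -
      obtain i where i: "card (orbit ?K ?f C) = p ^ i"
        using orb[OF C] divides_primepow_nat[OF p] by blast
      with neg C have "i \<noteq> 0" by auto
      with i show ?thesis by (metis dvd_power gr_zeroI)
    qed
    have "card ?E = (\<Sum>X\<in>orbits ?K ?E ?f. card X)"
      using act.disjoint_sum[OF finE, of "\<lambda>_. 1::nat"] by simp
    moreover have "p dvd (\<Sum>X\<in>orbits ?K ?E ?f. card X)"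
      using pd by (intro dvd_sum) (auto simp: orbits_def)
    ultimately show False using cardE m(2) by simp
  qed
  then obtain C where C: "C \<in> ?E" "card (orbit ?K ?f C) = 1" by blast
  then obtain g where g: "g \<in> carrier G" "C = T #> g" by (auto simp: RCOSETS_def)
  have TG: "T \<subseteq> carrier G" using T(1) subgroup.subset by blast
  have HG: "H \<subseteq> carrier G" using H subgroup.subset by blast
  have fixC: "C #> inv h = C" if h: "h \<in> H" for h
  proof -
    obtain D where D: "orbit ?K ?f C = {D}" using C(2) card_1_singletonE by blast
    have "C \<in> orbit ?K ?f C" using act.orbit_refl C(1) by blast
    moreover have "?f h C \<in> orbit ?K ?f C" using h by (auto simp: orbit_def)
    ultimately show ?thesis using D C(1) by auto
  qed
  let ?S = "inv g <# T #> g"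
  have S: "subgroup ?S G"
    using T(1) g(1) by (intro subgroup_conjugation_is_surj1)
  have cS: "card ?S = card T"
  proof -
    have "?S = (\<lambda>t. inv g \<otimes> t \<otimes> g) ` T" by (auto simp: r_coset_def l_coset_def)
    moreover have "inj_on (\<lambda>t. inv g \<otimes> t \<otimes> g) T"
    proof (rule inj_on_inverseI)
      fix t assume "t \<in> T"
      then show "g \<otimes> (inv g \<otimes> t \<otimes> g) \<otimes> inv g = t"
        using TG g(1) by (simp add: m_assoc subset_iff flip: m_assoc[of g "inv g"])
    qed
    ultimately show ?thesis by (simp add: card_image)
  qed
  have "h \<in> ?S" if h: "h \<in> H" for h
  proof -
    have hG: "h \<in> carrier G" using h HG by blast
    have "C #> h = C" using fixC[of "inv h"] h H hG by (simp add: subgroup.m_inv_closed)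
    moreover have "g \<in> C" using g T(1) rcos_self by blast
    moreover have "g \<otimes> h \<in> C #> h" using \<open>g \<in> C\<close> by (auto simp: r_coset_def)
    ultimately have "g \<otimes> h \<in> T #> g" using g(2) by simp
    then obtain t where t: "t \<in> T" "g \<otimes> h = t \<otimes> g" by (auto simp: r_coset_def)
    then have "h = inv g \<otimes> t \<otimes> g" using g(1) hG TG
      by (metis inv_solve_left m_assoc m_closed inv_closed subsetD)
    then show ?thesis using t by (auto simp: r_coset_def l_coset_def)
  qed
  then have "H \<subseteq> ?S" by blast
  moreover have "sylow_subgroup p ?S G"
    using S cS T(2) fin by (simp add: sylow_subgroup_def a_def)
  ultimately show ?thesis by (intro exI conjI)
qed

section \<open>Blocks of three-cycles\<close>

text \<open>Groups are bare sets of functions on the whole type: no support is fixed, so groups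
  acting on different sets can be combined directly.\<close>

definition perm_group :: "('a \<Rightarrow> 'a) set \<Rightarrow> bool"
  where "perm_group H \<longleftrightarrow> id \<in> H \<and>
    (\<forall>f\<in>H. bij f \<and> inv' f \<in> H \<and> (\<forall>g\<in>H. f \<circ> g \<in> H))"

lemma perm_group_id: "perm_group H \<Longrightarrow> id \<in> H"
  and perm_group_bij: "perm_group H \<Longrightarrow> f \<in> H \<Longrightarrow> bij f"
  and perm_group_inv: "perm_group H \<Longrightarrow> f \<in> H \<Longrightarrow> inv' f \<in> H"
  and perm_group_comp: "perm_group H \<Longrightarrow> f \<in> H \<Longrightarrow> g \<in> H \<Longrightarrow> f \<circ> g \<in> H"
  by (auto simp: perm_group_def)

lemma perm_group_funpow: "perm_group H \<Longrightarrow> f \<in> H \<Longrightarrow> f ^^ k \<in> H"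
  by (induction k) (auto simp: perm_group_id perm_group_comp id_def[symmetric])

lemma perm_group_conj_cycle:
  assumes "perm_group H" "g \<in> H" "cycle_of_list cs \<in> H" "distinct cs"
  shows "cycle_of_list (map g cs) \<in> H"
  using conjugation_of_cycle[OF assms(4), of g] assms
  by (metis perm_group_bij perm_group_comp perm_group_inv)

lemma three_cycle_rotate: "cycle_of_list [y, z, x] = cycle_of_list [x, y, z]"
  if "distinct [x, y, z]"
  using cycle_of_list_rotate_independent[OF that, of 1] by simp

lemma three_cycle_inv: "inv' (cycle_of_list [x, y, z]) = cycle_of_list [z, y, x]"
  if "distinct [x, y, z]"
proof (rule inv_unique_comp)
  show "cycle_of_list [x, y, z] \<circ> cycle_of_list [z, y, x] = id"
    "cycle_of_list [z, y, x] \<circ> cycle_of_list [x, y, z] = id"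
    using that by (auto simp: fun_eq_iff transpose_def)
qed

text \<open>This is vacuous for sets with fewer than three points, which is why
  \<open>three_points\<close> accompanies it below.\<close>

definition full :: "('a \<Rightarrow> 'a) set \<Rightarrow> 'a set \<Rightarrow> bool"
  where "full H S \<longleftrightarrow>
    (\<forall>x\<in>S. \<forall>y\<in>S. \<forall>z\<in>S. distinct [x, y, z] \<longrightarrow> cycle_of_list [x, y, z] \<in> H)"

lemma fullD:
  "full H S \<Longrightarrow> x \<in> S \<Longrightarrow> y \<in> S \<Longrightarrow> z \<in> S \<Longrightarrow> distinct [x, y, z] \<Longrightarrow> cycle_of_list [x, y, z] \<in> H"
  unfolding full_def by blast

lemma full_mono: "full H T \<Longrightarrow> S \<subseteq> T \<Longrightarrow> full H S"
  unfolding full_def by blast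

lemma full_image:
  assumes H: "perm_group H" and g: "g \<in> H" and S: "full H S"
  shows "full H (g ` S)"
  unfolding full_def
proof (intro ballI impI)
  fix x y z assume xyz: "x \<in> g ` S" "y \<in> g ` S" "z \<in> g ` S" "distinct [x, y, z]"
  then obtain x' y' z' where p: "x' \<in> S" "y' \<in> S" "z' \<in> S" "x = g x'" "y = g y'" "z = g z'"
    by blast
  with xyz have d: "distinct [x', y', z']" by auto
  show "cycle_of_list [x, y, z] \<in> H"
    using perm_group_conj_cycle[OF H g fullD[OF S p(1-3) d] d] p by simp
qed

lemma three_cycle_full:
  assumes H: "perm_group H" and xyz: "cycle_of_list [x, y, z] \<in> H" "distinct [x, y, z]"
  shows "full H {x, y, z}"
proof -
  have rot: "cycle_of_list [b, c, a] \<in> H"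
    if "cycle_of_list [a, b, c] \<in> H" "distinct [a, b, c]" for a b c
    using three_cycle_rotate[OF that(2)] that(1) by (simp only:)
  have 1: "cycle_of_list [y, z, x] \<in> H" using rot[OF xyz] .
  have 2: "cycle_of_list [z, x, y] \<in> H" using rot[OF 1] xyz(2) by auto
  have 3: "cycle_of_list [z, y, x] \<in> H"
    using three_cycle_inv[OF xyz(2)] perm_group_inv[OF H xyz(1)] by (simp only:)
  have 4: "cycle_of_list [y, x, z] \<in> H" using rot[OF 3] xyz(2) by auto
  have 5: "cycle_of_list [x, z, y] \<in> H" using rot[OF 4] xyz(2) by auto
  show ?thesis
    unfolding full_def using xyz 1 2 3 4 5 by (auto simp del: cycle_of_list.simps)
qed

text \<open>A single 3-cycle (u v w) leading out of \<open>S\<close> suffices: inversion and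
  conjugation by 3-cycles of \<open>S\<close> turn it into (x y w) for all distinct
  \<open>x\<close>, \<open>y\<close> in \<open>S\<close>.\<close>

lemma full_insert_aux:
  assumes H: "perm_group H" and S: "full H S" and w: "w \<notin> S"
    and uv: "u \<in> S" "v \<in> S" "u \<noteq> v" "cycle_of_list [u, v, w] \<in> H"
  shows "full H (insert w S)"
proof -
  define R where "R u v \<longleftrightarrow> u \<in> S \<and> v \<in> S \<and> u \<noteq> v \<and> cycle_of_list [u, v, w] \<in> H" for u v
  have ne: "u \<noteq> w" if "u \<in> S" for u using that w by blast
  have sym: "R v u" if "R u v" for u v
  proof -
    have d: "distinct [u, v, w]" using that ne by (auto simp: R_def)
    have "cycle_of_list [u, v, w] \<in> H" using that by (simp add: R_def)
    from three_cycle_full[OF H this d] have "cycle_of_list [v, u, w] \<in> H"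
      by (rule fullD) (use d in auto)
    then show ?thesis using that by (auto simp: R_def)
  qed
  have step: "R u x" if "R u v" "x \<in> S" "x \<noteq> u" for u v x
  proof (cases "x = v")
    case False
    have uvS: "u \<in> S" "v \<in> S" "u \<noteq> v" using that(1) by (auto simp: R_def)
    \<comment> \<open>This 3-cycle sends \<open>u\<close> to \<open>x\<close> and \<open>v\<close>
      to \<open>u\<close> and fixes \<open>w\<close>, so it conjugates (u v w) to (x u w).\<close>
    define g where "g = cycle_of_list [u, x, v]"
    have g: "g \<in> H" using fullD[OF S, of u x v] uvS that False by (auto simp: g_def)
    have "cycle_of_list (map g [u, v, w]) \<in> H"
      using that(1) uvS ne by (intro perm_group_conj_cycle[OF H g]) (auto simp: R_def)
    moreover have "map g [u, v, w] = [x, u, w]"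
      using that uvS False ne[of u] ne[of v] ne[of x] by (auto simp: g_def transpose_def)
    ultimately have "R x u" using that uvS by (auto simp: R_def)
    then show ?thesis by (rule sym)
  qed (use that in simp)
  have R: "R x y" if "x \<in> S" "y \<in> S" "x \<noteq> y" for x y
  proof -
    have uv': "R u v" using uv by (simp add: R_def)
    show ?thesis
    proof (cases "x = u")
      case True then show ?thesis using step[OF uv' that(2)] that(3) by simp
    next
      case False
      then have "R x u" using step[OF uv' that(1)] sym by simp
      then show ?thesis using step that by blast
    qed
  qed
  show ?thesis unfolding full_def
  proof (intro ballI impI)
    fix x y z assume a: "x \<in> insert w S" "y \<in> insert w S" "z \<in> insert w S" "distinct [x, y, z]"
    then consider "x \<in> S" "y \<in> S" "z \<in> S" | "z = w" "x \<in> S" "y \<in> S" | "x = w" "y \<in> S" "z \<in> S"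
      | "y = w" "x \<in> S" "z \<in> S" by auto
    then show "cycle_of_list [x, y, z] \<in> H"
    proof cases
      case 1 then show ?thesis using fullD[OF S] a by blast
    next
      case 2 then show ?thesis using R[of x y] a by (auto simp: R_def)
    next
      case 3
      then have "cycle_of_list [y, z, x] \<in> H" using R[of y z] a by (auto simp: R_def)
      then show ?thesis using three_cycle_rotate[OF a(4)] by (simp only:)
    next
      case 4
      then have "cycle_of_list [z, x, y] \<in> H" using R[of z x] a by (auto simp: R_def)
      moreover have "cycle_of_list [x, y, z] = cycle_of_list [z, x, y]"
        using a(4) by (intro three_cycle_rotate) auto
      ultimately show ?thesis by (simp only:)
    qed
  qed
qed

definition three_points :: "'a set \<Rightarrow> bool"
  where "three_points S \<longleftrightarrow> (\<exists>x\<in>S. \<exists>y\<in>S. \<exists>z\<in>S. distinct [x, y, z])"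

text \<open>Two common points \<open>u\<close>, \<open>v\<close> give (u v w) at once. If
  \<open>u\<close> is the only common point, the 3-cycle (u w t) of \<open>T\<close> fixes the rest
  of \<open>S\<close> and moves a 3-cycle (a b u) of \<open>S\<close> to (a b w).\<close>

lemma full_insert:
  assumes H: "perm_group H" and S: "full H S" "three_points S" and T: "full H T" "three_points T"
    and "S \<inter> T \<noteq> {}" and w: "w \<in> T"
  shows "full H (insert w S)"
proof (cases "w \<in> S")
  case True then show ?thesis using S by (simp add: insert_absorb)
next
  case False
  obtain u where u: "u \<in> S" "u \<in> T" using assms by blast
  have uw: "u \<noteq> w" using u False by blast
  show ?thesis
  proof (cases "\<exists>v. v \<in> S \<and> v \<in> T \<and> v \<noteq> u")
    case True
    then obtain v where v: "v \<in> S" "v \<in> T" "v \<noteq> u" by blast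
    then have "cycle_of_list [u, v, w] \<in> H" using fullD[OF T(1)] u w uw False by auto
    then show ?thesis using full_insert_aux[OF H S(1) False u(1) v(1)] v by blast
  next
    case no: False
    obtain t where t: "t \<in> T" "t \<noteq> u" "t \<noteq> w" using T(2) unfolding three_points_def by auto
    then have tS: "t \<notin> S" using no by blast
    obtain a b where ab: "a \<in> S" "b \<in> S" "a \<noteq> b" "a \<noteq> u" "b \<noteq> u"
      using S(2) unfolding three_points_def by (metis distinct_length_2_or_more)
    define g where "g = cycle_of_list [u, w, t]"
    have g: "g \<in> H" using fullD[OF T(1) u(2) w t(1)] t uw by (auto simp: g_def)
    have d: "distinct [a, b, u]" using ab by auto
    have "cycle_of_list (map g [a, b, u]) \<in> H"
      using perm_group_conj_cycle[OF H g fullD[OF S(1) ab(1,2) u(1) d] d] .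
    moreover have "map g [a, b, u] = [a, b, w]"
      using ab t tS uw False u by (auto simp: g_def transpose_def)
    ultimately show ?thesis using full_insert_aux[OF H S(1) False ab(1,2,3)] by simp
  qed
qed

lemma full_Un:
  assumes H: "perm_group H" and S: "full H S" "three_points S" and T: "full H T" "three_points T"
    and ST: "S \<inter> T \<noteq> {}"
  shows "full H (S \<union> T)"
  unfolding full_def
proof (intro ballI impI)
  fix x y z assume a: "x \<in> S \<union> T" "y \<in> S \<union> T" "z \<in> S \<union> T" "distinct [x, y, z]"
  have ins: "full H (insert w S') \<and> three_points (insert w S')"
    if "full H S'" "S \<subseteq> S'" "w \<in> S \<union> T" for w S'
  proof -
    have "three_points S'" using that(2) S(2) unfolding three_points_def by blast
    then have "three_points (insert w S')" unfolding three_points_def by blast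
    moreover have "full H (insert w S')"
    proof (cases "w \<in> T")
      case True then show ?thesis
        using full_insert[OF H that(1) \<open>three_points S'\<close> T] ST that(2) by blast
    next
      case False then show ?thesis using that by (simp add: insert_absorb subsetD)
    qed
    ultimately show ?thesis by blast
  qed
  have "full H (insert x (insert y (insert z S)))"
    using ins[of "insert y (insert z S)" x] ins[of "insert z S" y] ins[of S z] a S by blast
  then show "cycle_of_list [x, y, z] \<in> H" by (rule fullD) (use a(4) in auto)
qed

section \<open>Maximal full sets as blocks, and the cycles they absorb\<close>

definition block :: "('a \<Rightarrow> 'a) set \<Rightarrow> 'a set \<Rightarrow> bool"
  where "block H M \<longleftrightarrow> (\<forall>g\<in>H. \<forall>x\<in>M. g x \<in> M \<longrightarrow> (\<forall>y\<in>M. g y \<in> M))"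

lemma blockD: "block H M \<Longrightarrow> g \<in> H \<Longrightarrow> x \<in> M \<Longrightarrow> g x \<in> M \<Longrightarrow> y \<in> M \<Longrightarrow> g y \<in> M"
  unfolding block_def by blast

text \<open>The union of all full supersets of \<open>S\<close> is full, since any two of them meet.
  If \<open>g\<close> carries one of its points back into it, its image is a full set meeting it;
  the union of both is then itself one of these supersets, hence nothing new.\<close>

lemma exists_block:
  assumes H: "perm_group H" and S: "full H S" "three_points S"
  obtains M where "S \<subseteq> M" "full H M"  "block H M"
proof -
  define M where "M = \<Union>{T. S \<subseteq> T \<and> full H T}"
  have three_points: "three_points T" if "S \<subseteq> T" for T using that S(2) unfolding three_points_def by blast
  have ne: "S \<noteq> {}" using S(2) unfolding three_points_def by blast
  have SM: "S \<subseteq> M" using S by (auto simp: M_def)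
  have Un: "full H (T \<union> U)" if "S \<subseteq> T" "S \<subseteq> U" "full H T" "full H U" for T U
    using full_Un[OF H that(3) three_points[OF that(1)] that(4) three_points[OF that(2)]] that ne by blast
  have M: "full H M" unfolding full_def
  proof (intro ballI impI)
    fix x y z assume "x \<in> M" "y \<in> M" "z \<in> M" and d: "distinct [x, y, z]"
    then obtain T U V where "S \<subseteq> T" "full H T" "x \<in> T" "S \<subseteq> U" "full H U" "y \<in> U"
      "S \<subseteq> V" "full H V" "z \<in> V" unfolding M_def by blast
    note TUV = this
    then have "full H ((T \<union> U) \<union> V)" by (intro Un) auto
    then show "cycle_of_list [x, y, z] \<in> H" by (rule fullD) (use TUV d in auto)
  qed
  have "g y \<in> M" if g: "g \<in> H" and x: "x \<in> M" "g x \<in> M" and y: "y \<in> M" for g x y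
  proof -
    have inj: "g a = g b \<longleftrightarrow> a = b" for a b
      using perm_group_bij[OF H g] by (metis bij_pointE)
    have "three_points (g ` M)"
      using three_points[OF SM] unfolding three_points_def by (simp add: inj)
    moreover have "M \<inter> g ` M \<noteq> {}" using x by (metis IntI empty_iff imageI)
    ultimately have "full H (M \<union> g ` M)"
      using full_Un[OF H M three_points[OF SM] full_image[OF H g M]] by blast
    moreover have "S \<subseteq> M \<union> g ` M" using SM by blast
    ultimately have "M \<union> g ` M \<subseteq> \<Union>{T. S \<subseteq> T \<and> full H T}" by blast
    then have "M \<union> g ` M \<subseteq> M" by (simp only: M_def)
    then show ?thesis using y by blast
  qed
  then have "block H M" unfolding block_def by (intro ballI impI)
  with SM M show ?thesis by (rule that)
qed

lemma cycle_funpow_nth: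
  assumes "distinct cs" "i < length cs"
  shows "(cycle_of_list cs ^^ k) (cs ! i) = cs ! ((i + k) mod length cs)"
proof -
  have "(cycle_of_list cs ^^ k) (cs ! i) = map (cycle_of_list cs ^^ k) cs ! i"
    using assms by simp
  also have "\<dots> = cs ! ((i + k) mod length cs)"
    using assms by (simp add: cyclic_rotation nth_rotate add.commute)
  finally show ?thesis .
qed

text \<open>Some nontrivial power of the cycle carries a point of \<open>M\<close> into
  \<open>M\<close>: the first power if \<open>y\<close> is fixed by the cycle, otherwise the power
  that takes \<open>x\<close> to \<open>y\<close>. That power preserves \<open>M\<close>, and
  because the length is prime its iterates carry \<open>x\<close> through the whole cycle.\<close>

lemma block_absorbs_prime_cycle:
  assumes H: "perm_group H" and cs: "distinct cs" "prime (length cs)" "cycle_of_list cs \<in> H"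
    and blk: "block H M"
    and x: "x \<in> M" "x \<in> set cs" and y: "y \<in> M" "y \<noteq> x"
  shows "set cs \<subseteq> M"
proof
  fix z assume "z \<in> set cs"
  then obtain t where t: "t < length cs" "z = cs ! t" by (auto simp: in_set_conv_nth)
  let ?a = "cycle_of_list cs" and ?p = "length cs"
  obtain i where i: "i < ?p" "x = cs ! i" using x by (auto simp: in_set_conv_nth)
  have "\<exists>k w. 0 < k \<and> k < ?p \<and> w \<in> M \<and> (?a ^^ k) w \<in> M"
  proof (cases "y \<in> set cs")
    case False
    then have "(?a ^^ 1) y = y" by (simp add: id_outside_supp)
    then show ?thesis using prime_gt_1_nat[OF cs(2)] y(1)
      by (intro exI[of _ "1::nat"] exI[of _ y]) simp
  next
    case True
    then obtain j where j: "j < ?p" "y = cs ! j" by (auto simp: in_set_conv_nth)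
    then have ij: "i \<noteq> j" using i y by blast
    define k where "k = (if i < j then j - i else ?p + j - i)"
    have "(i + k) mod ?p = j"
    proof (cases "i < j")
      case True then show ?thesis using j by (simp add: k_def)
    next
      case False
      then have "i + k = j + ?p" using i by (simp add: k_def)
      then show ?thesis using j by simp
    qed
    then have "(?a ^^ k) x = y" using cycle_funpow_nth[OF cs(1) i(1)] i j by simp
    moreover have "0 < k" "k < ?p" using ij i j by (auto simp: k_def)
    ultimately show ?thesis using x(1) y(1) by (intro exI[of _ k] exI[of _ x]) simp
  qed
  then obtain k w where k: "0 < k" "k < ?p" and w: "w \<in> M" "(?a ^^ k) w \<in> M" by blast
  have kM: "(?a ^^ k) v \<in> M" if "v \<in> M" for v
    using blockD[OF blk perm_group_funpow[OF H cs(3)] w that] .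
  have "(?a ^^ (k * l)) x \<in> M" for l
    by (induction l) (simp_all add: x(1) funpow_add kM)
  moreover have "\<exists>l. (i + k * l) mod ?p = t"
  proof -
    have "coprime k ?p"
      using k cs(2) by (metis coprime_commute nat_dvd_not_less prime_imp_coprime)
    then obtain l' where "[k * l' = 1] (mod ?p)"
      using cong_solve_coprime_nat[of k ?p] by auto
    then have "[k * l' * (?p - i + t) = 1 * (?p - i + t)] (mod ?p)" by (rule cong_scalar_right)
    \<comment> \<open>Here \<open>l'\<close> inverts \<open>k\<close> modulo \<open>?p\<close>, so
      \<open>l\<close> steps of width \<open>k\<close> lead from position \<open>i\<close> to
      position \<open>t\<close>. The summand \<open>?p - i\<close> stands for \<open>- i\<close> in
      the naturals.\<close>
    moreover define l where "l = l' * (?p - i + t)"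
    ultimately have "[k * l = ?p - i + t] (mod ?p)" by (simp add: mult.assoc)
    then have "[i + k * l = i + (?p - i + t)] (mod ?p)" by (simp add: cong_add_lcancel_nat)
    then have "(i + k * l) mod ?p = t mod ?p" using i by (simp add: cong_def)
    then show ?thesis using t by auto
  qed
  ultimately show "z \<in> M"
    using cycle_funpow_nth[OF cs(1) i(1)] i t by metis
qed

section \<open>Permutation groups of prime power exponent\<close>

text \<open>The \<open>p\<close>-group property is imposed on the elements, by exponents; in this
  form it passes directly to products of commuting groups and to subgroups. \<open>X\<close> only
  bounds the support.\<close>

definition p_perm_group :: "nat \<Rightarrow> 'a set \<Rightarrow> ('a \<Rightarrow> 'a) set \<Rightarrow> bool"
  where "p_perm_group p X P \<longleftrightarrow>
    perm_group P \<and> (\<forall>f\<in>P. (\<forall>x. x \<notin> X \<longrightarrow> f x = x) \<and> (\<exists>k. f ^^ (p ^ k) = id))"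

text \<open>Closure under inverses is automatic: if the power of \<open>f\<close> with exponent
  \<open>p ^ k\<close> is \<open>id\<close>, the power with exponent \<open>p ^ k - 1\<close>
  inverts \<open>f\<close>.\<close>

lemma p_perm_groupI:
  assumes p: "p > 0" and id: "id \<in> P" and comp: "\<And>f g. f \<in> P \<Longrightarrow> g \<in> P \<Longrightarrow> f \<circ> g \<in> P"
    and supp: "\<And>f x. f \<in> P \<Longrightarrow> x \<notin> X \<Longrightarrow> f x = x"
    and exps: "\<And>f. f \<in> P \<Longrightarrow> \<exists>k. f ^^ (p ^ k) = id"
  shows "p_perm_group p X P"
proof -
  have pow: "f ^^ k \<in> P" if "f \<in> P" for f k
    using that by (induction k) (auto simp: id comp id_def[symmetric])
  have "bij f \<and> inv' f \<in> P" if f: "f \<in> P" for f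
  proof -
    obtain k where k: "f ^^ (p ^ k) = id" using exps[OF f] by blast
    have "p ^ k > 0" using p by simp
    then obtain m where m: "p ^ k = Suc m" using gr0_conv_Suc by blast
    have 1: "f \<circ> (f ^^ m) = id" using k m by simp
    have 2: "(f ^^ m) \<circ> f = id" using k m by (simp add: funpow_swap1 fun_eq_iff)
    have "inv' f = f ^^ m" using 1 2 by (rule inv_unique_comp)
    then show ?thesis using o_bij[OF 2 1] pow[OF f] by simp
  qed
  then show ?thesis
    unfolding p_perm_group_def perm_group_def using id comp supp exps by simp
qed

lemma p_perm_group_perm_group: "p_perm_group p X P \<Longrightarrow> perm_group P"
  and p_perm_group_supp: "p_perm_group p X P \<Longrightarrow> f \<in> P \<Longrightarrow> x \<notin> X \<Longrightarrow> f x = x"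
  and p_perm_group_exp: "p_perm_group p X P \<Longrightarrow> f \<in> P \<Longrightarrow> \<exists>k. f ^^ (p ^ k) = id"
  by (auto simp: p_perm_group_def)

lemma p_perm_group_permutes:
  assumes "p_perm_group p X P" "f \<in> P"
  shows "f permutes X"
  using p_perm_group_supp[OF assms] perm_group_bij[OF p_perm_group_perm_group[OF assms(1)] assms(2)]
  by (simp add: permutes_def bij_iff)

lemma evenperm_funpow:
  assumes "permutation f"
  shows "permutation (f ^^ k) \<and> (evenperm (f ^^ k) \<longleftrightarrow> evenperm f \<or> even k)"
proof (induction k)
  case 0 then show ?case by (simp add: id_def[symmetric])
next
  case (Suc k)
  then show ?case
    using permutation_compose[OF assms, of "f ^^ k"] evenperm_comp[OF assms, of "f ^^ k"]
    unfolding funpow.simps even_Suc by blast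
qed

text \<open>Some odd power of \<open>f\<close> is \<open>id\<close>, and odd powers have the parity
  of \<open>f\<close>.\<close>

lemma odd_p_perm_group_even:
  assumes "p_perm_group p X P" "f \<in> P" "finite X" "odd p"
  shows "evenperm f"
proof -
  have perm: "permutation f"
    using p_perm_group_permutes[OF assms(1,2)] assms(3) permutation_permutes by blast
  obtain k where "f ^^ (p ^ k) = id" using p_perm_group_exp[OF assms(1,2)] by blast
  then show ?thesis using evenperm_funpow[OF perm, of "p ^ k"] assms(4) by simp
qed

lemma p_perm_group_cycle:
  assumes "distinct cs" "length cs = p" "p > 0"
  shows "p_perm_group p (set cs) (range (\<lambda>i. cycle_of_list cs ^^ i))"
proof (rule p_perm_groupI)
  show "id \<in> range (\<lambda>i. cycle_of_list cs ^^ i)" by (rule range_eqI[of _ _ 0]) (simp add: id_def)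
  show "f \<circ> g \<in> range (\<lambda>i. cycle_of_list cs ^^ i)"
    if "f \<in> range (\<lambda>i. cycle_of_list cs ^^ i)" "g \<in> range (\<lambda>i. cycle_of_list cs ^^ i)" for f g
    using that by (auto simp: funpow_add[symmetric])
  show "f x = x" if f: "f \<in> range (\<lambda>i. cycle_of_list cs ^^ i)" and x: "x \<notin> set cs" for f x
  proof -
    have "(cycle_of_list cs ^^ i) x = x" for i
      by (induction i) (simp_all add: id_outside_supp x)
    then show ?thesis using f by auto
  qed
  show "\<exists>k. f ^^ (p ^ k) = id" if f: "f \<in> range (\<lambda>i. cycle_of_list cs ^^ i)" for f
  proof -
    obtain i where "f = cycle_of_list cs ^^ i" using f by blast
    then have "f ^^ (p ^ 1) = (cycle_of_list cs ^^ length cs) ^^ i"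
      using assms(2) by (simp add: funpow_mult mult.commute)
    also have "\<dots> = id" unfolding cycle_is_id_root[OF assms(1)] by (induction i) simp_all
    finally show ?thesis by blast
  qed
qed (use assms in simp)

lemma funpow_comp_commute:
  assumes "f \<circ> g = g \<circ> f"
  shows "(f \<circ> g) ^^ n = (f ^^ n) \<circ> (g ^^ n)"
proof -
  have c: "(f ^^ n) \<circ> g = g \<circ> (f ^^ n)" for n
  proof (induction n)
    case (Suc n)
    have "f ^^ Suc n \<circ> g = f \<circ> (f ^^ n \<circ> g)" by (simp only: funpow.simps comp_assoc)
    also have "\<dots> = (f \<circ> g) \<circ> f ^^ n" by (simp only: Suc comp_assoc)
    also have "\<dots> = g \<circ> f ^^ Suc n" by (simp only: assms funpow.simps comp_assoc)
    finally show ?case .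
  qed auto
  show ?thesis
  proof (induction n)
    case (Suc n)
    have "(f \<circ> g) ^^ Suc n = f \<circ> (g \<circ> f ^^ n) \<circ> g ^^ n"
      by (simp only: funpow.simps Suc comp_assoc)
    also have "\<dots> = f ^^ Suc n \<circ> g ^^ Suc n"
      by (simp only: c[symmetric] funpow.simps comp_assoc)
    finally show ?case .
  qed auto
qed

lemma permutes_disjoint_commute:
  assumes "f permutes X" "g permutes Y" "X \<inter> Y = {}"
  shows "f \<circ> g = g \<circ> f"
proof
  fix x
  consider "x \<in> X" | "x \<in> Y" | "x \<notin> X" "x \<notin> Y" by blast
  then show "(f \<circ> g) x = (g \<circ> f) x"
  proof cases
    case 1
    then have "f x \<in> X" using assms(1) by (simp add: permutes_in_image)
    then have "f x \<notin> Y" "x \<notin> Y" using 1 assms(3) by blast+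
    then show ?thesis using assms(2) by (simp add: permutes_not_in)
  next
    case 2
    then have "g x \<in> Y" using assms(2) by (simp add: permutes_in_image)
    then have "g x \<notin> X" "x \<notin> X" using 2 assms(3) by blast+
    then show ?thesis using assms(1) by (simp add: permutes_not_in)
  next
    case 3 then show ?thesis using assms by (simp add: permutes_not_in)
  qed
qed

lemma p_perm_group_prod:
  assumes P: "p_perm_group p X P" and C: "p_perm_group p Y C" and XY: "X \<inter> Y = {}" and p: "p > 0"
  shows "p_perm_group p (X \<union> Y) {f \<circ> g |f g. f \<in> P \<and> g \<in> C}"
proof (rule p_perm_groupI)
  have com: "f \<circ> g = g \<circ> f" if "f \<in> P" "g \<in> C" for f g
    using permutes_disjoint_commute[OF p_perm_group_permutes[OF P that(1)]
        p_perm_group_permutes[OF C that(2)] XY] .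
  note gP = p_perm_group_perm_group[OF P] and gC = p_perm_group_perm_group[OF C]
  show "id \<in> {f \<circ> g |f g. f \<in> P \<and> g \<in> C}"
    using perm_group_id[OF gP] perm_group_id[OF gC] by (metis (mono_tags, lifting) comp_id mem_Collect_eq)
  show "a \<circ> b \<in> {f \<circ> g |f g. f \<in> P \<and> g \<in> C}"
    if ab: "a \<in> {f \<circ> g |f g. f \<in> P \<and> g \<in> C}" "b \<in> {f \<circ> g |f g. f \<in> P \<and> g \<in> C}" for a b
  proof -
    obtain f g f' g' where d: "a = f \<circ> g" "b = f' \<circ> g'" "f \<in> P" "f' \<in> P" "g \<in> C" "g' \<in> C"
      using ab by auto
    have "a \<circ> b = f \<circ> (g \<circ> f') \<circ> g'" using d by (simp add: comp_assoc)
    also have "\<dots> = (f \<circ> f') \<circ> (g \<circ> g')"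
      unfolding com[OF d(4,5), symmetric] by (simp add: comp_assoc)
    finally show ?thesis using perm_group_comp[OF gP d(3,4)] perm_group_comp[OF gC d(5,6)] by blast
  qed
  show "f x = x" if "f \<in> {f \<circ> g |f g. f \<in> P \<and> g \<in> C}" "x \<notin> X \<union> Y" for f x
  proof -
    obtain a b where "f = a \<circ> b" "a \<in> P" "b \<in> C" using \<open>f \<in> _\<close> by auto
    then show ?thesis
      using that(2) p_perm_group_supp[OF P, of a x] p_perm_group_supp[OF C, of b x] by simp
  qed
  show "\<exists>k. a ^^ (p ^ k) = id" if a: "a \<in> {f \<circ> g |f g. f \<in> P \<and> g \<in> C}" for a
  proof -
    obtain f g where d: "a = f \<circ> g" "f \<in> P" "g \<in> C" using a by auto
    obtain k l where kl: "f ^^ (p ^ k) = id" "g ^^ (p ^ l) = id"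
      using p_perm_group_exp[OF P d(2)] p_perm_group_exp[OF C d(3)] by blast
    have pow_id: "(h ^^ m) ^^ n = id" if "h ^^ m = id" for h :: "'a \<Rightarrow> 'a" and m n
      unfolding that by (induction n) simp_all
    have "f ^^ (p ^ (k + l)) = (f ^^ (p ^ k)) ^^ (p ^ l)"
      by (simp add: funpow_mult power_add mult.commute)
    moreover have "g ^^ (p ^ (k + l)) = (g ^^ (p ^ l)) ^^ (p ^ k)"
      by (simp add: funpow_mult power_add mult.commute)
    ultimately have "a ^^ (p ^ (k + l)) = id"
      unfolding d(1) funpow_comp_commute[OF com[OF d(2,3)]]
      using pow_id[OF kl(1)] pow_id[OF kl(2)] by simp
    then show ?thesis by blast
  qed
qed (rule p)

text \<open>
  \<open>alt_pair p q S X Y\<close>: some \<open>p\<close>-group supported on \<open>X\<close> and some \<open>q\<close>-group supported on \<open>Y\<close> have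
  even elements that generate the alternating group of \<open>S\<close>. For the prime 2, where a cycle of
  length 2 is odd, a transposition is kept in the group: multiplying a new transposition by it
  gives an even element.
\<close>

definition spans :: "('a \<Rightarrow> 'a) set \<Rightarrow> 'a set \<Rightarrow> bool"
  where "spans A S \<longleftrightarrow> (\<forall>H. perm_group H \<and> (\<forall>f\<in>A. evenperm f \<longrightarrow> f \<in> H) \<longrightarrow> full H S)"

definition alt_pair :: "nat \<Rightarrow> nat \<Rightarrow> 'a set \<Rightarrow> 'a set \<Rightarrow> 'a set \<Rightarrow> bool"
  where "alt_pair p q S X Y \<longleftrightarrow> finite S \<and> three_points S \<and> X \<subseteq> S \<and> Y \<subseteq> S \<and>
    (\<exists>P Q. p_perm_group p X P \<and> p_perm_group q Y Q \<and>
      (p = 2 \<longrightarrow> (\<exists>x y. x \<noteq> y \<and> transpose x y \<in> P)) \<and>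
      (q = 2 \<longrightarrow> (\<exists>x y. x \<noteq> y \<and> transpose x y \<in> Q)) \<and> spans (P \<union> Q) S)"

lemma alt_pairE:
  assumes "alt_pair p q S X Y"
  obtains P Q where "finite S" "three_points S" "X \<subseteq> S" "Y \<subseteq> S"
    "p_perm_group p X P" "p_perm_group q Y Q"
    "p = 2 \<Longrightarrow> \<exists>x y. x \<noteq> y \<and> transpose x y \<in> P"
    "q = 2 \<Longrightarrow> \<exists>x y. x \<noteq> y \<and> transpose x y \<in> Q" "spans (P \<union> Q) S"
  using assms unfolding alt_pair_def by (elim conjE exE) (rule that, simp_all)

lemma alt_pairI:
  assumes "finite S" "three_points S" "X \<subseteq> S" "Y \<subseteq> S"
    "p_perm_group p X P" "p_perm_group q Y Q"
    "p = 2 \<Longrightarrow> \<exists>x y. x \<noteq> y \<and> transpose x y \<in> P"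
    "q = 2 \<Longrightarrow> \<exists>x y. x \<noteq> y \<and> transpose x y \<in> Q" "spans (P \<union> Q) S"
  shows "alt_pair p q S X Y"
  unfolding alt_pair_def by (intro conjI exI[of _ P] exI[of _ Q] impI assms)

lemma alt_pair_sym:
  assumes "alt_pair p q S X Y"
  shows "alt_pair q p S Y X"
  using assms
proof (rule alt_pairE, goal_cases)
  case (1 P Q)
  then show ?case by (intro alt_pairI[of S Y X q Q p P]) (simp_all add: Un_commute)
qed

section \<open>Growing a configuration by one cycle\<close>

lemma adjoin_cycle_odd:
  assumes H: "perm_group H" and cs: "distinct cs" "prime (length cs)" "cycle_of_list cs \<in> H"
    and S: "full H S" "three_points S" and meet: "set cs \<inter> S \<noteq> {}"
  shows "full H (S \<union> set cs)"
proof -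
  obtain M where M: "S \<subseteq> M" "full H M"
    and blk: "block H M"
    using exists_block[OF H S] .
  obtain x where x: "x \<in> set cs" "x \<in> S" using meet by blast
  obtain y where y: "y \<in> S" "y \<noteq> x" using S(2) unfolding three_points_def by auto
  have "x \<in> M" "y \<in> M" using x y M(1) by blast+
  then have "set cs \<subseteq> M"
    using block_absorbs_prime_cycle[OF H cs blk _ x(1) _ y(2)] by blast
  then have "S \<union> set cs \<subseteq> M" using M(1) by simp
  then show ?thesis using full_mono[OF M(2)] by (simp only:)
qed

text \<open>Handles even elements that are not cycles, in particular double transpositions: one
  point of \<open>S\<close> that stays in \<open>S\<close> certifies that \<open>g\<close> preserves
  the block around \<open>S\<close>, so the images of all other points of \<open>S\<close> may be
  added.\<close>

lemma adjoin_point: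
  assumes H: "perm_group H" and S: "full H S" "three_points S"
    and g: "g \<in> H" and x: "x \<in> S" "g x \<in> S" and z: "z \<in> S"
  shows "full H (insert (g z) S)"
proof -
  obtain M where M: "S \<subseteq> M" "full H M"
    and blk: "block H M"
    using exists_block[OF H S] .
  have "g z \<in> M" using blockD[OF blk g, of x z] x z M(1) by blast
  then show ?thesis using M full_mono[OF M(2)] by simp
qed

text \<open>The group on \<open>X\<close> is multiplied by the cyclic group of a
  \<open>p\<close>-cycle on \<open>Z\<close>. The factors commute because \<open>Z\<close> avoids
  \<open>X\<close>, and the block around \<open>S\<close> absorbs \<open>Z\<close> because
  \<open>Z\<close> meets \<open>S\<close>.\<close>

lemma alt_pair_adjoin:
  assumes alt_pair: "alt_pair p q S X Y" and p: "prime p" and Z: "finite Z" "card Z = p"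
    and ZX: "X \<inter> Z = {}" and ZS: "Z \<inter> S \<noteq> {}"
  shows "alt_pair p q (S \<union> Z) (X \<union> Z) Y"
proof -
  from alt_pair obtain P Q where S: "finite S" "three_points S" "X \<subseteq> S" "Y \<subseteq> S"
    and P: "p_perm_group p X P" and Q: "p_perm_group q Y Q"
    and P2: "p = 2 \<longrightarrow> (\<exists>x y. x \<noteq> y \<and> transpose x y \<in> P)"
    and Q2: "q = 2 \<longrightarrow> (\<exists>x y. x \<noteq> y \<and> transpose x y \<in> Q)" and sp: "spans (P \<union> Q) S"
    unfolding alt_pair_def by metis
  obtain cs where cs: "distinct cs" "set cs = Z" using finite_distinct_list[OF Z(1)] by blast
  have len: "length cs = p" using cs Z(2) distinct_card by fastforce
  have p0: "p > 0" using p prime_gt_0_nat by blast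
  define C where "C = range (\<lambda>i. cycle_of_list cs ^^ i)"
  have C: "p_perm_group p Z C"
    using p_perm_group_cycle[OF cs(1) len p0] cs(2) by (simp add: C_def)
  define P' where "P' = {f \<circ> g |f g. f \<in> P \<and> g \<in> C}"
  have P': "p_perm_group p (X \<union> Z) P'"
    unfolding P'_def by (rule p_perm_group_prod[OF P C ZX p0])
  have idP: "id \<in> P" and idC: "id \<in> C"
    using P C p_perm_group_perm_group perm_group_id by blast+
  have PP': "f \<in> P'" if "f \<in> P" for f
    using that idC unfolding P'_def by (metis (mono_tags, lifting) comp_id mem_Collect_eq)
  have cC: "cycle_of_list cs \<in> C" unfolding C_def by (rule range_eqI[of _ _ 1]) simp
  have "full H (S \<union> Z)"
    if H: "perm_group H" and even: "\<And>f. f \<in> P' \<union> Q \<Longrightarrow> evenperm f \<Longrightarrow> f \<in> H" for H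
  proof -
    have fS: "full H S"
      using sp H even PP' unfolding spans_def by (metis Un_iff)
    show ?thesis
    proof (cases "p = 2")
      case False
      then have "odd p" using p primes_dvd_imp_eq two_is_prime_nat by blast
      have cP': "cycle_of_list cs \<in> P'"
        using idP cC unfolding P'_def by (metis (mono_tags, lifting) id_comp mem_Collect_eq)
      have "finite (X \<union> Z)" using S(1,3) Z(1) finite_subset by blast
      then have "evenperm (cycle_of_list cs)"
        using odd_p_perm_group_even[OF P' cP' _ \<open>odd p\<close>] by blast
      then have "cycle_of_list cs \<in> H" using even cP' by blast
      then show ?thesis
        using adjoin_cycle_odd[OF H cs(1) _ _ fS S(2)] cs(2) len p ZS by metis
    next
      case True
      \<comment> \<open>The new transposition (a b) is odd, but (x y)(a b) is even. It maps
        \<open>x\<close> to \<open>y\<close>, both in \<open>S\<close>, so it preserves the block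
        around \<open>S\<close> and takes \<open>a\<close> to the new point
        \<open>b\<close>.\<close>
      then obtain x y where xy: "x \<noteq> y" "transpose x y \<in> P" using P2 by blast
      have xX: "x \<in> X" "y \<in> X"
        using p_perm_group_supp[OF P xy(2)] xy(1) by (metis transpose_apply_first, metis transpose_apply_second)
      obtain a where a: "a \<in> Z" "a \<in> S" using ZS by blast
      have "card (Z - {a}) = 1" using Z True a by simp
      then obtain b where b: "Z - {a} = {b}" using card_1_singletonE by blast
      then have Zab: "Z = {a, b}" "a \<noteq> b" using a by blast+
      have "cycle_of_list cs = transpose a b"
      proof -
        obtain u v where uv: "cs = [u, v]" using len True
          by (metis One_nat_def Suc_1 length_0_conv length_Suc_conv)
        with cs Zab have "(u = a \<and> v = b) \<or> (u = b \<and> v = a)" by auto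
        then show ?thesis using uv by (auto simp: transpose_commute)
      qed
      then have tP': "transpose x y \<circ> transpose a b \<in> P'"
        using xy(2) cC unfolding P'_def by auto
      have "evenperm (transpose x y \<circ> transpose a b)"
        using xy(1) Zab(2) by (simp add: evenperm_comp permutation_swap_id evenperm_swap)
      then have gH: "transpose x y \<circ> transpose a b \<in> H" using even tP' by blast
      have ne: "a \<noteq> x" "a \<noteq> y" "b \<noteq> x" "b \<noteq> y" using xX ZX Zab by blast+
      have "full H (insert ((transpose x y \<circ> transpose a b) a) S)"
        using S(3) xX a ne by (intro adjoin_point[OF H fS S(2) gH, of x]) auto
      moreover have "(transpose x y \<circ> transpose a b) a = b" using ne by simp
      moreover have "S \<union> Z = insert b S" using Zab a by blast
      ultimately show ?thesis by simp
    qed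
  qed
  then have "spans (P' \<union> Q) (S \<union> Z)" unfolding spans_def by blast
  moreover have "three_points (S \<union> Z)" using S(2) unfolding three_points_def by blast
  moreover have "p = 2 \<longrightarrow> (\<exists>x y. x \<noteq> y \<and> transpose x y \<in> P')" using P2 PP' by blast
  moreover have "finite (S \<union> Z)" "X \<union> Z \<subseteq> S \<union> Z" "Y \<subseteq> S \<union> Z" using S Z by auto
  ultimately show ?thesis unfolding alt_pair_def using P' Q Q2 by meson
qed

section \<open>From configurations to Sylow subgroups of \<open>alt_group n\<close>\<close>

lemma p_perm_group_in_sylow:
  assumes n: "2 \<le> n" and p: "prime p" and P: "p_perm_group p X P" and X: "X \<subseteq> {1..n}"
  shows "\<exists>T. sylow_subgroup p T (alt_group n) \<and> (\<forall>f\<in>P. evenperm f \<longrightarrow> f \<in> T)"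
proof -
  interpret G: group "alt_group n" by (rule alt_group_is_group)
  let ?G = "alt_group n"
  define E where "E = {f \<in> P. evenperm f}"
  note gP = p_perm_group_perm_group[OF P]
  have perm: "f permutes {1..n}" if "f \<in> P" for f
    using p_perm_group_permutes[OF P that] X permutes_subset by blast
  have Ecar: "E \<subseteq> carrier ?G" using perm by (auto simp: E_def alt_group_carrier)
  have permE: "permutation f" if "f \<in> E" for f using that Ecar alt_group_carrier' by blast
  have E: "subgroup E ?G"
  proof (rule G.subgroupI)
    show "E \<subseteq> carrier ?G" by (rule Ecar)
    have "id \<in> E" using perm_group_id[OF gP] by (simp add: E_def)
    then show "E \<noteq> {}" by blast
    show "inv\<^bsub>?G\<^esub> a \<in> E" if "a \<in> E" for a
    proof -
      have "inv\<^bsub>?G\<^esub> a = inv' a" using that Ecar by (intro alt_group_inv_equality) blast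
      then show ?thesis using that perm_group_inv[OF gP] evenperm_inv[OF permE[OF that]]
        by (simp add: E_def)
    qed
    show "a \<otimes>\<^bsub>?G\<^esub> b \<in> E" if "a \<in> E" "b \<in> E" for a b
      using that perm_group_comp[OF gP, of a b] evenperm_comp[of a b] permE[of a] permE[of b]
      by (simp add: E_def alt_group_mult)
  qed
  have pow: "x [^]\<^bsub>?G\<^esub> (k::nat) = x ^^ k" for x k
    by (induction k) (simp_all add: alt_group_one alt_group_mult funpow_swap1 fun_eq_iff)
  have fin: "finite (carrier ?G)"
  proof (rule finite_subset)
    show "carrier ?G \<subseteq> {f. f permutes {1..n}}" by (auto simp: alt_group_carrier)
  qed (simp add: finite_permutations)
  have "\<exists>T. E \<subseteq> T \<and> sylow_subgroup p T ?G"
  proof (rule G.p_subgroup_subset_sylow[OF fin p E])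
    fix x assume "x \<in> E"
    then show "\<exists>k. x [^]\<^bsub>?G\<^esub> p ^ k = \<one>\<^bsub>?G\<^esub>"
      using p_perm_group_exp[OF P, of x] by (simp add: E_def pow alt_group_one)
  qed
  then show ?thesis unfolding E_def by blast
qed

text \<open>The subgroup generated by the two Sylow subgroups is one of the groups over which
  \<open>spans\<close> quantifies, so it contains all 3-cycles, and these generate
  \<open>alt_group n\<close>.\<close>

lemma alt_pair_sylow_generate:
  assumes n: "2 \<le> n" and pq: "prime p" "prime q" and alt_pair: "alt_pair p q {1..n} X Y"
  shows "\<exists>P Q. sylow_subgroup p P (alt_group n) \<and> sylow_subgroup q Q (alt_group n) \<and>
    generate (alt_group n) (P \<union> Q) = carrier (alt_group n)"
proof -
  interpret G: group "alt_group n" by (rule alt_group_is_group)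
  let ?G = "alt_group n"
  from alt_pair obtain P Q where P: "p_perm_group p X P" and Q: "p_perm_group q Y Q"
    and XY: "X \<subseteq> {1..n}" "Y \<subseteq> {1..n}" and sp: "spans (P \<union> Q) {1..n}"
    unfolding alt_pair_def by metis
  obtain T U where T: "sylow_subgroup p T ?G" "\<forall>f\<in>P. evenperm f \<longrightarrow> f \<in> T"
    and U: "sylow_subgroup q U ?G" "\<forall>f\<in>Q. evenperm f \<longrightarrow> f \<in> U"
    using p_perm_group_in_sylow[OF n pq(1) P XY(1)] p_perm_group_in_sylow[OF n pq(2) Q XY(2)] by metis
  have TU: "T \<union> U \<subseteq> carrier ?G"
    using T(1) U(1) subgroup.subset unfolding sylow_subgroup_def by blast
  let ?H = "generate ?G (T \<union> U)"
  have sub: "subgroup ?H ?G" using TU by (rule G.generate_is_subgroup)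
  have Hc: "?H \<subseteq> carrier ?G" using sub subgroup.subset by blast
  have "perm_group ?H" unfolding perm_group_def
  proof (intro conjI ballI)
    show "id \<in> ?H" using subgroup.one_closed[OF sub] by (simp add: alt_group_one)
    fix f assume f: "f \<in> ?H"
    then have fc: "f \<in> carrier ?G" using Hc by blast
    then show "bij f" using alt_group_carrier' permutation by blast
    show "inv' f \<in> ?H"
      using subgroup.m_inv_closed[OF sub f] alt_group_inv_equality[OF fc] by simp
    show "f \<circ> g \<in> ?H" if "g \<in> ?H" for g
      using subgroup.m_closed[OF sub f that] by (simp add: alt_group_mult)
  qed
  moreover have "f \<in> ?H" if "f \<in> P \<union> Q" "evenperm f" for f
    using that T(2) U(2) generate.incl[of f "T \<union> U"] by blast
  ultimately have full: "full ?H {1..n}" using sp unfolding spans_def by blast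
  have "three_cycles n \<subseteq> ?H"
  proof
    fix f assume "f \<in> three_cycles n"
    then obtain cs where cs: "f = cycle_of_list cs" "distinct cs" "length cs = 3" "set cs \<subseteq> {1..n}"
      by blast
    obtain x y z where xyz: "cs = [x, y, z]"
      using cs(3) by (metis length_0_conv length_Suc_conv numeral_3_eq_3)
    show "f \<in> ?H" using fullD[OF full, of x y z] cs unfolding xyz by simp
  qed
  then have "generate ?G (three_cycles n) \<subseteq> ?H"
    using G.generate_subgroup_incl[OF _ sub] by blast
  then have "?H = carrier ?G" using Hc alt_group_carrier_as_three_cycles[of n] by simp
  then show ?thesis using T(1) U(1) by blast
qed

section \<open>Enlarging the support\<close>

lemma alt_pair_finite: "alt_pair p q S X Y \<Longrightarrow> finite S"
  and alt_pair_subset1: "alt_pair p q S X Y \<Longrightarrow> X \<subseteq> S"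
  and alt_pair_subset2: "alt_pair p q S X Y \<Longrightarrow> Y \<subseteq> S"
  by (auto simp: alt_pair_def)

text \<open>What has to be counted are the free points, those of \<open>S\<close> outside
  \<open>X\<close> or outside \<open>Y\<close>: only through them can a further cycle be attached.
  The new \<open>p\<close>-cycle consists of \<open>E\<close> and \<open>p - card E\<close> free
  points, at least one because \<open>card E < p\<close>.\<close>

lemma alt_pair_extend1:
  assumes alt_pair: "alt_pair p q S X Y" and p: "prime p" and E: "finite E" "E \<inter> S = {}" "card E < p"
    and le: "p \<le> card E + card (S - X)"
  obtains X' where "alt_pair p q (S \<union> E) X' Y"
    "card (S \<union> E - X') = card E + card (S - X) - p" "card (S \<union> E - Y) = card (S - Y) + card E"
proof -
  note S = alt_pair_finite[OF alt_pair] alt_pair_subset1[OF alt_pair] alt_pair_subset2[OF alt_pair]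
  have "p - card E \<le> card (S - X)" using le by simp
  then obtain I where I: "I \<subseteq> S - X" "card I = p - card E" "finite I"
    using obtain_subset_with_card_n by metis
  have "card (I \<union> E) = card I + card E" using I E by (intro card_Un_disjoint) auto
  then have cZ: "card (I \<union> E) = p" using I(2) E(3) by simp
  have "I \<noteq> {}" using I(2) E(3) by auto
  then have "alt_pair p q (S \<union> (I \<union> E)) (X \<union> (I \<union> E)) Y"
    using I E S by (intro alt_pair_adjoin[OF alt_pair p _ cZ]) auto
  moreover have "S \<union> (I \<union> E) = S \<union> E" using I by blast
  ultimately have g: "alt_pair p q (S \<union> E) (X \<union> (I \<union> E)) Y" by simp
  have "S \<union> E - (X \<union> (I \<union> E)) = (S - X) - I" using E(2) by blast
  then have "card (S \<union> E - (X \<union> (I \<union> E))) = card (S - X) - card I"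
    using I by (simp add: card_Diff_subset)
  then have c1: "card (S \<union> E - (X \<union> (I \<union> E))) = card E + card (S - X) - p"
    using I(2) E(3) le by simp
  have "S \<union> E - Y = (S - Y) \<union> E" using E(2) S(3) by blast
  moreover have "card ((S - Y) \<union> E) = card (S - Y) + card E"
    using E S by (intro card_Un_disjoint) auto
  ultimately show ?thesis using g c1 that by simp
qed

lemma alt_pair_extend2:
  assumes alt_pair: "alt_pair p q S X Y" and q: "prime q" and E: "finite E" "E \<inter> S = {}" "card E < q"
    and le: "q \<le> card E + card (S - Y)"
  obtains Y' where "alt_pair p q (S \<union> E) X Y'"
    "card (S \<union> E - Y') = card E + card (S - Y) - q" "card (S \<union> E - X) = card (S - X) + card E"
  using alt_pair_extend1[OF alt_pair_sym[OF alt_pair] q E le] alt_pair_sym by metis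

text \<open>
  A new \<open>p\<close>-cycle through one free point of \<open>S - X\<close> adds \<open>p - 1\<close> points to \<open>S\<close>; the last cycle uses up
  as many further free points as needed to hit the prescribed size exactly.
\<close>

lemma alt_pair_extend_many1:
  assumes "alt_pair p q S X Y" "prime p" "finite E" "E \<inter> S = {}"
    and "p \<le> card (S - X) + 1" "card E < card (S - X)"
  shows "\<exists>X'. alt_pair p q (S \<union> E) X' Y"
  using assms
proof (induction "card E" arbitrary: S X E rule: less_induct)
  case less
  have p2: "p \<ge> 2" using less.prems(2) prime_ge_2_nat by blast
  show ?case
  proof (cases "card E < p - 1")
    case True
    show ?thesis
    proof (cases "E = {}")
      case False
      then have "card E > 0" using less.prems(3) card_gt_0_iff by blast
      then have "card E < p" "p \<le> card E + card (S - X)" using True less.prems(5) by linarith+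
      then show ?thesis using alt_pair_extend1[OF less.prems(1-4)] by metis
    qed (use less.prems in auto)
  next
    case False
    then have "p - 1 \<le> card E" by simp
    \<comment> \<open>A cycle with \<open>p - 1\<close> new points costs one free point, while the
      number of points still to be added drops by \<open>p - 1 \<ge> 1\<close>. This preserves
      \<open>card E < card (S - X)\<close>.\<close>
    then obtain D where D: "D \<subseteq> E" "card D = p - 1" "finite D"
      using obtain_subset_with_card_n by metis
    obtain X' where X': "alt_pair p q (S \<union> D) X' Y" "card (S \<union> D - X') = card D + card (S - X) - p"
    proof (rule alt_pair_extend1[OF less.prems(1,2) D(3)])
      show "D \<inter> S = {}" using D(1) less.prems(4) by blast
    qed (use D less.prems(6) False p2 in auto)
    have cE: "card (E - D) = card E - (p - 1)" using D by (simp add: card_Diff_subset)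
    have "\<exists>X''. alt_pair p q ((S \<union> D) \<union> (E - D)) X'' Y"
      by (rule less.hyps[OF _ X'(1) less.prems(2)]) (use X' cE D p2 less.prems False in auto)
    moreover have "(S \<union> D) \<union> (E - D) = S \<union> E" using D by blast
    ultimately show ?thesis by simp
  qed
qed

text \<open>Cycles of the two kinds alternate, since the new points of a \<open>q\<close>-cycle are
  free for the \<open>p\<close>-group and vice versa. A round of one \<open>q\<close>-cycle with
  \<open>q - 1\<close> new points and one \<open>p\<close>-cycle with \<open>p - 1\<close> new
  points changes the two numbers of free points by \<open>q - 2\<close> and \<open>p - 2\<close>, so
  both bounds persist. A remainder too short for the next step is covered by
  \<open>p\<close>-cycles.\<close>

lemma alt_pair_extend:
  assumes "alt_pair p q S X Y" "prime p" "prime q" "p \<le> q" "finite E" "E \<inter> S = {}"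
    and "q \<le> card (S - X) + 1" "p \<le> card (S - Y) + 1"
  shows "\<exists>X' Y'. alt_pair p q (S \<union> E) X' Y'"
  using assms
proof (induction "card E" arbitrary: S X Y E rule: less_induct)
  case less
  have p2: "p \<ge> 2" using less.prems(2) prime_ge_2_nat by blast
  show ?case
  proof (cases "card E < q - 1")
    case True
    then have "p \<le> card (S - X) + 1" "card E < card (S - X)" using less.prems(4,7) by linarith+
    then show ?thesis using alt_pair_extend_many1[OF less.prems(1,2,5,6)] by blast
  next
    case False
    then have "q - 1 \<le> card E" by simp
    then obtain D where D: "D \<subseteq> E" "card D = q - 1" "finite D"
      using obtain_subset_with_card_n by metis
    obtain Y' where Y': "alt_pair p q (S \<union> D) X Y'" "card (S \<union> D - Y') = card D + card (S - Y) - q"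
      "card (S \<union> D - X) = card (S - X) + card D"
    proof (rule alt_pair_extend2[OF less.prems(1,3) D(3)])
      show "D \<inter> S = {}" using D(1) less.prems(6) by blast
    qed (use D less.prems p2 in auto)
    have cE: "card (E - D) = card E - (q - 1)" using D by (simp add: card_Diff_subset)
    show ?thesis
    proof (cases "card (E - D) < p - 1")
      case True
      have "\<exists>X''. alt_pair p q ((S \<union> D) \<union> (E - D)) X'' Y'"
        by (rule alt_pair_extend_many1[OF Y'(1) less.prems(2)])
          (use less.prems True Y'(3) D in auto)
      moreover have "(S \<union> D) \<union> (E - D) = S \<union> E" using D by blast
      ultimately show ?thesis by auto
    next
      case False
      then have "p - 1 \<le> card (E - D)" by simp
      then obtain F where F: "F \<subseteq> E - D" "card F = p - 1" "finite F"
        using obtain_subset_with_card_n by metis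
      obtain X' where X': "alt_pair p q (S \<union> D \<union> F) X' Y'"
        "card (S \<union> D \<union> F - X') = card F + card (S \<union> D - X) - p"
        "card (S \<union> D \<union> F - Y') = card (S \<union> D - Y') + card F"
      proof (rule alt_pair_extend1[OF Y'(1) less.prems(2) F(3)])
        show "F \<inter> (S \<union> D) = {}" using F(1) less.prems(6) by blast
      qed (use F D less.prems p2 Y'(3) in auto)
      have "D \<noteq> {}" using D(2) p2 less.prems(4) by auto
      then have "E - D - F \<subset> E" using D(1) by blast
      then have cF: "card (E - D - F) < card E" by (rule psubset_card_mono[OF less.prems(5)])
      have "\<exists>X'' Y''. alt_pair p q ((S \<union> D \<union> F) \<union> (E - D - F)) X'' Y''"
      proof (rule less.hyps[OF cF X'(1) less.prems(2-4)])
        show "q \<le> card (S \<union> D \<union> F - X') + 1"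
          unfolding X'(2) Y'(3) F(2) D(2) using p2 less.prems by linarith
        show "p \<le> card (S \<union> D \<union> F - Y') + 1"
          unfolding X'(3) Y'(2) F(2) D(2) using p2 less.prems by linarith
      qed (use less.prems in auto)
      moreover have "(S \<union> D \<union> F) \<union> (E - D - F) = S \<union> E" using D F by blast
      ultimately show ?thesis by simp
    qed
  qed
qed

section \<open>Odd primes\<close>

text \<open>Common frame of all odd cases; only the 3-cycle in \<open>three\<close> depends on the
  construction. Its support meets one of the two cycles, which is absorbed, and the other follows
  since the two cycles meet.\<close>

lemma alt_pair_two_cycles:
  assumes pq: "prime p" "prime q" "odd p" "odd q"
    and as: "distinct as" "length as = p" and bs: "distinct bs" "length bs = q"
    and meet: "set as \<inter> set bs \<noteq> {}"
    and three: "\<And>H. perm_group H \<Longrightarrow> cycle_of_list as \<in> H \<Longrightarrow> cycle_of_list bs \<in> H \<Longrightarrow>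
      \<exists>x y z. distinct [x, y, z] \<and> {x, y, z} \<subseteq> set as \<union> set bs \<and> cycle_of_list [x, y, z] \<in> H"
  shows "alt_pair p q (set as \<union> set bs) (set as) (set bs)"
proof (rule alt_pairI)
  have p0: "p > 0" "q > 0" using pq prime_gt_0_nat by blast+
  show P: "p_perm_group p (set as) (range (\<lambda>i. cycle_of_list as ^^ i))"
    by (rule p_perm_group_cycle[OF as p0(1)])
  show Q: "p_perm_group q (set bs) (range (\<lambda>i. cycle_of_list bs ^^ i))"
    by (rule p_perm_group_cycle[OF bs p0(2)])
  have a: "cycle_of_list as \<in> range (\<lambda>i. cycle_of_list as ^^ i)"
    and b: "cycle_of_list bs \<in> range (\<lambda>i. cycle_of_list bs ^^ i)"
    by (rule range_eqI[of _ _ 1], simp)+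
  have "finite (set as)" "card (set as) = p" using as distinct_card by auto
  moreover have "p \<ge> 3" using pq(1,3) prime_ge_2_nat[of p] by (cases "p = 2") auto
  ultimately have "three_points (set as)"
  proof -
    obtain x y z cs where "as = x # y # z # cs"
      using as(2) \<open>p \<ge> 3\<close> by (metis (no_types) Suc_le_length_iff numeral_3_eq_3)
    then show ?thesis using as(1) by (auto simp: three_points_def)
  qed
  then show "three_points (set as \<union> set bs)" unfolding three_points_def by blast
  show "spans (range (\<lambda>i. cycle_of_list as ^^ i) \<union> range (\<lambda>i. cycle_of_list bs ^^ i)) (set as \<union> set bs)"
    unfolding spans_def
  proof (intro allI impI, elim conjE)
    fix H :: "('a \<Rightarrow> 'a) set"
    assume H: "perm_group H" and ev: "\<forall>f\<in>range (\<lambda>i. cycle_of_list as ^^ i) \<union>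
      range (\<lambda>i. cycle_of_list bs ^^ i). evenperm f \<longrightarrow> f \<in> H"
    have aH: "cycle_of_list as \<in> H"
      using ev a odd_p_perm_group_even[OF P a _ pq(3)] by (meson List.finite_set UnI1)
    have bH: "cycle_of_list bs \<in> H"
      using ev b odd_p_perm_group_even[OF Q b _ pq(4)] by (meson List.finite_set UnI2)
    obtain x y z where d: "distinct [x, y, z]" and sub: "{x, y, z} \<subseteq> set as \<union> set bs"
      and c: "cycle_of_list [x, y, z] \<in> H" using three[OF H aH bH] by metis
    let ?T = "{x, y, z}"
    have T: "full H ?T" "three_points ?T" using three_cycle_full[OF H c d] d by (auto simp: three_points_def)
    have three_points: "three_points (?T \<union> U)" for U using T(2) unfolding three_points_def by blast
    have pr: "prime (length as)" "prime (length bs)" using as bs pq by auto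
    consider "set as \<inter> ?T \<noteq> {}" | "set bs \<inter> ?T \<noteq> {}" using sub by blast
    then have "full H (?T \<union> (set as \<union> set bs))"
    proof cases
      case 1
      have 2: "full H (?T \<union> set as)" by (rule adjoin_cycle_odd[OF H as(1) pr(1) aH T 1])
      have "set bs \<inter> (?T \<union> set as) \<noteq> {}" using meet by blast
      from adjoin_cycle_odd[OF H bs(1) pr(2) bH 2 three_points this] show ?thesis by (simp only: Un_assoc)
    next
      case 2
      have 1: "full H (?T \<union> set bs)" by (rule adjoin_cycle_odd[OF H bs(1) pr(2) bH T 2])
      have "set as \<inter> (?T \<union> set bs) \<noteq> {}" using meet by blast
      from adjoin_cycle_odd[OF H as(1) pr(1) aH 1 three_points this] show ?thesis
        by (simp only: Un_assoc Un_commute[of "set as"])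
    qed
    then show "full H (set as \<union> set bs)" by (rule full_mono) blast
  qed
qed (use pq in auto)

section \<open>Commutators of two cycles that share an interval\<close>

lemma cycle_of_list_rotate1: "distinct (x # cs) \<Longrightarrow> cycle_of_list (cs @ [x]) = cycle_of_list (x # cs)"
  using cycle_of_list_rotate_independent[of "x # cs" 1] by simp

lemma cycle_of_list_append_commute:
  "distinct (xs @ ys) \<Longrightarrow> cycle_of_list (xs @ ys) = cycle_of_list (ys @ xs)"
  using cycle_of_list_rotate_independent[of "xs @ ys" "length xs"] by (simp add: rotate_append)

lemma map_cycle_of_list_prefix:
  assumes "distinct (x # xs @ y # ys)"
  shows "map (cycle_of_list (x # xs @ y # ys)) (x # xs) = xs @ [y]"
proof -
  have "map (cycle_of_list (x # xs @ y # ys)) (x # xs @ y # ys) = xs @ y # ys @ [x]"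
    using cyclic_rotation[OF assms, of 1] by simp
  then have "map (cycle_of_list (x # xs @ y # ys)) (x # xs) @
      map (cycle_of_list (x # xs @ y # ys)) (y # ys) = (xs @ [y]) @ (ys @ [x])"
    by (simp del: cycle_of_list.simps)
  then show ?thesis by (subst (asm) append_eq_append_conv) (simp_all del: cycle_of_list.simps)
qed

text \<open>
  Conjugating the first cycle by the second shifts the common interval \<open>o0 # W\<close> by one place. The
  quotient of the first cycle by its conjugate then moves only three or four points.
\<close>

lemma shifted_cycle_mem:
  assumes H: "perm_group H" and d: "distinct (o0 # W @ om # V @ U)"
    and a: "cycle_of_list (o0 # W @ U) \<in> H" and b: "cycle_of_list (o0 # W @ om # V) \<in> H"
  shows "cycle_of_list (W @ om # U) \<in> H"
proof -
  let ?b = "cycle_of_list (o0 # W @ om # V)"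
  have "cycle_of_list (map ?b (o0 # W @ U)) \<in> H"
    using d by (intro perm_group_conj_cycle[OF H b a]) auto
  moreover have "map ?b U = U"
    using d by (intro map_idI id_outside_supp) auto
  moreover have "map ?b (o0 # W) = W @ [om]"
    using d by (intro map_cycle_of_list_prefix) auto
  moreover have "map ?b (o0 # W @ U) = map ?b (o0 # W) @ map ?b U" by simp
  ultimately show ?thesis by (metis append.assoc append_Cons append_Nil)
qed

lemma perm_group_quotient:
  assumes "perm_group H" "d \<circ> a' \<in> H" "a' \<in> H"
  shows "d \<in> H"
proof -
  have "a' \<circ> inv' a' = id"
    using perm_group_bij[OF assms(1,3)] bij_is_surj surj_iff by blast
  then have "(d \<circ> a') \<circ> inv' a' = d" by (simp add: comp_assoc)
  then show ?thesis using perm_group_comp[OF assms(1,2) perm_group_inv[OF assms(1,3)]] by simp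
qed

text \<open>The case of an empty \<open>W\<close>: the conjugate is the first cycle with
  \<open>o0\<close> replaced by \<open>om\<close>.\<close>

lemma commutator_one_point:
  assumes H: "perm_group H" and d: "distinct (o0 # om # V @ u # U)"
    and a: "cycle_of_list (o0 # u # U) \<in> H" and b: "cycle_of_list (o0 # om # V) \<in> H"
  shows "cycle_of_list [o0, u, om] \<in> H"
proof (rule perm_group_quotient[OF H])
  show a': "cycle_of_list (om # u # U) \<in> H"
    using shifted_cycle_mem[OF H, of o0 "[]" om V "u # U"] a b d by simp
  have "transpose u om \<circ> transpose om u = id" by (simp add: transpose_commute[of om])
  then have "cycle_of_list [o0, u, om] \<circ> cycle_of_list (om # u # U) = cycle_of_list (o0 # u # U)"
    by (simp add: fun_eq_iff)
  then show "cycle_of_list [o0, u, om] \<circ> cycle_of_list (om # u # U) \<in> H" using a by simp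
qed

text \<open>The case of an empty \<open>U\<close>: the conjugate, after a rotation, is again the
  first cycle with \<open>o0\<close> replaced by \<open>om\<close>.\<close>

lemma commutator_prefix:
  assumes H: "perm_group H" and d: "distinct (o0 # o1 # W @ om # V)"
    and a: "cycle_of_list (o0 # o1 # W) \<in> H" and b: "cycle_of_list (o0 # o1 # W @ om # V) \<in> H"
  shows "cycle_of_list [o0, o1, om] \<in> H"
proof (rule perm_group_quotient[OF H])
  have "cycle_of_list (o1 # W @ [om]) \<in> H"
    using shifted_cycle_mem[OF H, of o0 "o1 # W" om V "[]"] a b d by simp
  moreover have "cycle_of_list (o1 # W @ [om]) = cycle_of_list (om # o1 # W)"
    using cycle_of_list_rotate1[of om "o1 # W"] d by auto
  ultimately show a': "cycle_of_list (om # o1 # W) \<in> H" by metis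
  have "cycle_of_list [o0, o1, om] \<circ> cycle_of_list (om # o1 # W) = cycle_of_list (o0 # o1 # W)"
    by (simp add: fun_eq_iff transpose_commute[of om])
  then show "cycle_of_list [o0, o1, om] \<circ> cycle_of_list (om # o1 # W) \<in> H" using a by simp
qed

text \<open>If the interval has at least two points and the first cycle also leaves the second one,
  the shift alters the first cycle at two separate places, which leaves a double
  transposition.\<close>

lemma commutator_interval:
  assumes H: "perm_group H" and d: "distinct (o0 # o1 # W @ om # V @ u # U)"
    and a: "cycle_of_list (o0 # o1 # W @ u # U) \<in> H" and b: "cycle_of_list (o0 # o1 # W @ om # V) \<in> H"
  shows "transpose o0 o1 \<circ> transpose om u \<in> H"
proof (rule perm_group_quotient[OF H])
  have "cycle_of_list (o1 # W @ om # u # U) \<in> H"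
    using shifted_cycle_mem[OF H, of o0 "o1 # W" om V "u # U"] a b d by simp
  moreover have "cycle_of_list (o1 # W @ om # u # U) = cycle_of_list (om # u # U @ o1 # W)"
    using cycle_of_list_append_commute[of "o1 # W" "om # u # U"] d by auto
  ultimately show a': "cycle_of_list (om # u # U @ o1 # W) \<in> H" by metis
  have "cycle_of_list (u # U @ o1 # W) = cycle_of_list (o1 # W @ u # U)"
    using cycle_of_list_append_commute[of "u # U" "o1 # W"] d by auto
  then have "transpose o0 o1 \<circ> transpose om u \<circ> cycle_of_list (om # u # U @ o1 # W) =
      cycle_of_list (o0 # o1 # W @ u # U)"
    by (simp add: fun_eq_iff)
  then show "transpose o0 o1 \<circ> transpose om u \<circ> cycle_of_list (om # u # U @ o1 # W) \<in> H"
    using a by simp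
qed

text \<open>The product is (x y)(z w) times the 3-cycle (v u)(v' u), with disjoint supports.
  Squaring kills the first factor and inverts the 3-cycle.\<close>

lemma double_transpositions_three_cycle:
  assumes "distinct [x, y, z, w, u, v, v']"
  shows "((transpose x y \<circ> transpose v u) \<circ> (transpose z w \<circ> transpose v' u)) ^^ 2 =
    cycle_of_list [u, v, v']"
proof
  fix t
  have ne: "x \<noteq> y" "x \<noteq> z" "x \<noteq> w" "x \<noteq> u" "x \<noteq> v" "x \<noteq> v'" "y \<noteq> z" "y \<noteq> w" "y \<noteq> u" "y \<noteq> v"
    "y \<noteq> v'" "z \<noteq> w" "z \<noteq> u" "z \<noteq> v" "z \<noteq> v'" "w \<noteq> u" "w \<noteq> v" "w \<noteq> v'" "u \<noteq> v" "u \<noteq> v'" "v \<noteq> v'"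
    using assms by simp_all
  have "t = x \<or> t = y \<or> t = z \<or> t = w \<or> t = u \<or> t = v \<or> t = v' \<or>
    t \<notin> {x, y, z, w, u, v, v'}" by blast
  then show "(((transpose x y \<circ> transpose v u) \<circ> (transpose z w \<circ> transpose v' u)) ^^ 2) t =
    cycle_of_list [u, v, v'] t"
    by (elim disjE) (simp_all add: numeral_2_eq_2 ne ne[symmetric])
qed

lemma transpose_conj: "bij g \<Longrightarrow> x \<noteq> y \<Longrightarrow> g \<circ> transpose x y \<circ> inv' g = transpose (g x) (g y)"
  using conjugation_of_cycle[of "[x, y]" g] by simp

text \<open>The \<open>i\<close>-th power of the cycle on \<open>bs\<close> fixes \<open>u\<close>
  and shifts the other three positions in \<open>d\<close> by \<open>i\<close>. Distinctness of the
  six indices means that \<open>d\<close> and its conjugate share only \<open>u\<close>.\<close>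

lemma commutator_interval_three_cycle:
  assumes H: "perm_group H" and bs: "distinct bs" "length bs = q" "set bs \<inter> set (u # U) = {}"
    and U: "distinct (u # U)" and m: "2 \<le> m" "m < q"
    and a: "cycle_of_list (take m bs @ u # U) \<in> H" and b: "cycle_of_list bs \<in> H"
    and i: "distinct [0, 1, m, i, i + 1, (m + i) mod q]" "i + 1 < q"
  shows "\<exists>x y z. distinct [x, y, z] \<and> {x, y, z} \<subseteq> set bs \<union> {u} \<and> cycle_of_list [x, y, z] \<in> H"
proof -
  define d where "d = transpose (bs ! 0) (bs ! 1) \<circ> transpose (bs ! m) u"
  have dH: "d \<in> H"
  proof -
    obtain o0 o1 cs where cs: "bs = o0 # o1 # cs"
      using bs(2) m by (metis (no_types) Suc_le_length_iff numeral_2_eq_2 less_imp_le_nat order_trans)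
    define k where "k = m - 2"
    have k: "m = Suc (Suc k)" using m(1) by (simp add: k_def)
    have kc: "k < length cs" using m(2) bs(2) cs k by simp
    have e: "bs = o0 # o1 # take k cs @ cs ! k # drop (Suc k) cs"
      using cs id_take_nth_drop[OF kc] by simp
    have "transpose o0 o1 \<circ> transpose (cs ! k) u \<in> H"
    proof (rule commutator_interval[OF H])
      show "distinct (o0 # o1 # take k cs @ cs ! k # drop (Suc k) cs @ u # U)"
        using bs(1,3) U unfolding e by (auto simp: distinct_append)
      show "cycle_of_list (o0 # o1 # take k cs @ u # U) \<in> H" using a by (simp add: cs k)
      show "cycle_of_list (o0 # o1 # take k cs @ cs ! k # drop (Suc k) cs) \<in> H"
        using b e by simp
    qed
    then show ?thesis by (simp add: d_def cs k)
  qed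
  have lt: "0 < q" "1 < q" "m < q" "i < q" "i + 1 < q" "(m + i) mod q < q" using m i(2) by auto
  have uB: "u \<noteq> bs ! j" if "j < q" for j using that bs(2,3) nth_mem[of j bs] by auto
  have ne: "bs ! j \<noteq> bs ! k" if "j < q" "k < q" "j \<noteq> k" for j k
    using nth_eq_iff_index_eq[OF bs(1)] that bs(2) by metis
  define g where "g = cycle_of_list bs ^^ i"
  have gH: "g \<in> H" unfolding g_def by (rule perm_group_funpow[OF H b])
  have bij: "bij g" using perm_group_bij[OF H gH] .
  have g: "g (bs ! j) = bs ! ((j + i) mod q)" if "j < q" for j
    using cycle_funpow_nth[OF bs(1), of j i] that bs(2) by (simp add: g_def)
  have gu: "g u = u"
  proof -
    have "u \<notin> set bs" using bs(3) by auto
    then have "(cycle_of_list bs ^^ i) u = u" for i by (induction i) (simp_all add: id_outside_supp)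
    then show ?thesis by (simp add: g_def)
  qed
  have "g \<circ> d \<circ> inv' g = (g \<circ> transpose (bs ! 0) (bs ! 1) \<circ> inv' g) \<circ> (g \<circ> transpose (bs ! m) u \<circ> inv' g)"
    using bij by (simp add: d_def fun_eq_iff bij_is_inj)
  also have "\<dots> = transpose (g (bs ! 0)) (g (bs ! 1)) \<circ> transpose (g (bs ! m)) (g u)"
    using transpose_conj[OF bij] ne[of 0 1] uB[of m] lt by simp
  also have "\<dots> = transpose (bs ! i) (bs ! (i + 1)) \<circ> transpose (bs ! ((m + i) mod q)) u"
    unfolding gu using g[of 0] g[of 1] g[of m] m i(2) by (simp add: add.commute)
  finally have d'H: "transpose (bs ! i) (bs ! (i + 1)) \<circ> transpose (bs ! ((m + i) mod q)) u \<in> H"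
    using perm_group_comp[OF H perm_group_comp[OF H gH dH] perm_group_inv[OF H gH]] by metis
  let ?js = "[0, 1, m, i, i + 1, (m + i) mod q]"
  have "inj_on ((!) bs) (set ?js)"
    by (rule inj_on_nth[OF bs(1)]) (use lt bs(2) in simp)
  then have "distinct (map ((!) bs) ?js)"
    using i(1) by (simp only: distinct_map)
  moreover have "u \<notin> set (map ((!) bs) ?js)" using uB lt by auto
  ultimately have dist: "distinct [bs ! 0, bs ! 1, bs ! i, bs ! (i + 1), u, bs ! m, bs ! ((m + i) mod q)]"
    by (simp (no_asm_use)) metis
  have "cycle_of_list [u, bs ! m, bs ! ((m + i) mod q)] \<in> H"
    using perm_group_funpow[OF H perm_group_comp[OF H dH d'H], of 2]
    unfolding d_def double_transpositions_three_cycle[OF dist] .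
  moreover have "bs ! m \<in> set bs" "bs ! ((m + i) mod q) \<in> set bs" using lt bs(2) by auto
  ultimately show ?thesis using dist
    by (intro exI[of _ u] exI[of _ "bs ! m"] exI[of _ "bs ! ((m + i) mod q)"]) auto
qed

text \<open>Used when the product of the two cycles has one 3-cycle and otherwise only cycles whose
  lengths divide \<open>e\<close>, with \<open>e\<close> prime to 3; then the \<open>e\<close>-th
  power is a 3-cycle on the same three points. Points outside \<open>{1..n}\<close> are fixed by
  both sides, so finitely many evaluations decide the identity.\<close>

lemma alt_pair_two_cycles_word:
  fixes as bs :: "nat list"
  assumes pq: "prime p" "prime q" "odd p" "odd q"
    and as: "distinct as" "length as = p" and bs: "distinct bs" "length bs = q"
    and meet: "set as \<inter> set bs \<noteq> {}" and n: "set as \<union> set bs = {1..n}"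
    and xyz: "distinct [x, y, z]" "{x, y, z} \<subseteq> {1..n}"
    and word: "\<And>t. t \<in> {1..n} \<Longrightarrow>
      ((cycle_of_list as \<circ> cycle_of_list bs) ^^ e) t = cycle_of_list [x, y, z] t"
  shows "\<exists>X Y. alt_pair p q {1..n} X Y"
proof -
  have out: "((cycle_of_list as \<circ> cycle_of_list bs) ^^ e) t = cycle_of_list [x, y, z] t"
    if "t \<notin> {1..n}" for t
  proof -
    have t: "t \<notin> set as" "t \<notin> set bs" using that n by blast+
    have "((cycle_of_list as \<circ> cycle_of_list bs) ^^ e) t = t"
      by (induction e) (simp_all add: id_outside_supp t)
    moreover have "t \<notin> set [x, y, z]" using that xyz(2) by auto
    then have "cycle_of_list [x, y, z] t = t" by (rule id_outside_supp)
    ultimately show ?thesis by simp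
  qed
  have w: "(cycle_of_list as \<circ> cycle_of_list bs) ^^ e = cycle_of_list [x, y, z]"
    using word out by (intro ext) blast
  have "alt_pair p q (set as \<union> set bs) (set as) (set bs)"
  proof (rule alt_pair_two_cycles[OF pq as bs meet])
    fix H assume H: "perm_group H" "cycle_of_list as \<in> H" "cycle_of_list bs \<in> H"
    have "cycle_of_list [x, y, z] \<in> H"
      unfolding w[symmetric] by (intro perm_group_funpow perm_group_comp H)
    then show "\<exists>x y z. distinct [x, y, z] \<and> {x, y, z} \<subseteq> set as \<union> set bs \<and> cycle_of_list [x, y, z] \<in> H"
      using xyz n by metis
  qed
  then show ?thesis unfolding n by blast
qed

text \<open>The pairs of cycles below were found by a computer search.\<close>

lemma alt_pair_5_5_6: "\<exists>X Y. alt_pair 5 5 {1..6::nat} X Y"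
proof (rule alt_pair_two_cycles_word[where as = "[1, 2, 3, 4, 6]" and bs = "[5, 4, 3, 2, 1]"
      and x = 1 and y = 5 and z = 6 and e = "Suc 0"])
  have ivl: "{1..6} = {1, 2, 3, 4, 5, 6::nat}"
    by (rule Set.set_eqI) (simp, presburger)
  show "set [1, 2, 3, 4, 6] \<union> set [5, 4, 3, 2, 1] = {1..6::nat}"
    unfolding ivl by auto
  show "((cycle_of_list [1, 2, 3, 4, 6] \<circ>
      cycle_of_list [5, 4, 3, 2, 1]) ^^ Suc 0) t =
    cycle_of_list [1, 5, 6] t" if "t \<in> {1..6}" for t :: nat
    using that unfolding ivl insert_iff empty_iff by (elim disjE FalseE; hypsubst; simp add: transpose_def)
qed simp_all

lemma alt_pair_5_5_7: "\<exists>X Y. alt_pair 5 5 {1..7::nat} X Y"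
proof (rule alt_pair_two_cycles_word[where as = "[4, 7, 3, 5, 6]" and bs = "[1, 2, 3, 4, 5]"
      and x = 1 and y = 5 and z = 2 and e = "Suc (Suc 0)"])
  have ivl: "{1..7} = {1, 2, 3, 4, 5, 6, 7::nat}"
    by (rule Set.set_eqI) (simp, presburger)
  show "set [4, 7, 3, 5, 6] \<union> set [1, 2, 3, 4, 5] = {1..7::nat}"
    unfolding ivl by auto
  show "((cycle_of_list [4, 7, 3, 5, 6] \<circ>
      cycle_of_list [1, 2, 3, 4, 5]) ^^ (Suc (Suc 0))) t =
    cycle_of_list [1, 5, 2] t" if "t \<in> {1..7}" for t :: nat
    using that unfolding ivl insert_iff empty_iff by (elim disjE FalseE; hypsubst; simp add: transpose_def)
qed simp_all

lemma alt_pair_5_5_8: "\<exists>X Y. alt_pair 5 5 {1..8::nat} X Y"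
proof (rule alt_pair_two_cycles_word[where as = "[3, 6, 1, 8, 7]" and bs = "[1, 2, 3, 4, 5]"
      and x = 1 and y = 6 and z = 2 and e = "Suc (Suc (Suc (Suc (Suc 0))))"])
  have ivl: "{1..8} = {1, 2, 3, 4, 5, 6, 7, 8::nat}"
    by (rule Set.set_eqI) (simp, presburger)
  show "set [3, 6, 1, 8, 7] \<union> set [1, 2, 3, 4, 5] = {1..8::nat}"
    unfolding ivl by auto
  show "((cycle_of_list [3, 6, 1, 8, 7] \<circ>
      cycle_of_list [1, 2, 3, 4, 5]) ^^ (Suc (Suc (Suc (Suc (Suc 0)))))) t =
    cycle_of_list [1, 6, 2] t" if "t \<in> {1..8}" for t :: nat
    using that unfolding ivl insert_iff empty_iff by (elim disjE FalseE; hypsubst; simp add: transpose_def)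
qed simp_all

lemma alt_pair_7_7_9: "\<exists>X Y. alt_pair 7 7 {1..9::nat} X Y"
proof (rule alt_pair_two_cycles_word[where as = "[7, 8, 1, 9, 3, 5, 6]" and bs = "[7, 6, 5, 4, 3, 2, 1]"
      and x = 2 and y = 3 and z = 9 and e = "Suc (Suc 0)"])
  have ivl: "{1..9} = {1, 2, 3, 4, 5, 6, 7, 8, 9::nat}"
    by (rule Set.set_eqI) (simp, presburger)
  show "set [7, 8, 1, 9, 3, 5, 6] \<union> set [7, 6, 5, 4, 3, 2, 1] = {1..9::nat}"
    unfolding ivl by auto
  show "((cycle_of_list [7, 8, 1, 9, 3, 5, 6] \<circ>
      cycle_of_list [7, 6, 5, 4, 3, 2, 1]) ^^ (Suc (Suc 0))) t =
    cycle_of_list [2, 3, 9] t" if "t \<in> {1..9}" for t :: nat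
    using that unfolding ivl insert_iff empty_iff by (elim disjE FalseE; hypsubst; simp add: transpose_def)
qed simp_all

lemma alt_pair_7_7_11: "\<exists>X Y. alt_pair 7 7 {1..11::nat} X Y"
proof (rule alt_pair_two_cycles_word[where as = "[11, 3, 7, 10, 2, 9, 8]" and bs = "[7, 6, 5, 4, 3, 2, 1]"
      and x = 1 and y = 10 and z = 2 and e = "Suc (Suc (Suc (Suc 0)))"])
  have ivl: "{1..11} = {1, 2, 3, 4, 5, 6, 7, 8, 9, 10, 11::nat}"
    by (rule Set.set_eqI) (simp, presburger)
  show "set [11, 3, 7, 10, 2, 9, 8] \<union> set [7, 6, 5, 4, 3, 2, 1] = {1..11::nat}"
    unfolding ivl by auto
  show "((cycle_of_list [11, 3, 7, 10, 2, 9, 8] \<circ>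
      cycle_of_list [7, 6, 5, 4, 3, 2, 1]) ^^ (Suc (Suc (Suc (Suc 0))))) t =
    cycle_of_list [1, 10, 2] t" if "t \<in> {1..11}" for t :: nat
    using that unfolding ivl insert_iff empty_iff by (elim disjE FalseE; hypsubst; simp add: transpose_def)
qed simp_all

lemma alt_pair_5_7_9: "\<exists>X Y. alt_pair 5 7 {1..9::nat} X Y"
proof (rule alt_pair_two_cycles_word[where as = "[9, 5, 8, 2, 7]" and bs = "[1, 2, 3, 4, 5, 6, 7]"
      and x = 5 and y = 6 and z = 9 and e = "Suc (Suc (Suc (Suc 0)))"])
  have ivl: "{1..9} = {1, 2, 3, 4, 5, 6, 7, 8, 9::nat}"
    by (rule Set.set_eqI) (simp, presburger)
  show "set [9, 5, 8, 2, 7] \<union> set [1, 2, 3, 4, 5, 6, 7] = {1..9::nat}"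
    unfolding ivl by auto
  show "((cycle_of_list [9, 5, 8, 2, 7] \<circ>
      cycle_of_list [1, 2, 3, 4, 5, 6, 7]) ^^ (Suc (Suc (Suc (Suc 0))))) t =
    cycle_of_list [5, 6, 9] t" if "t \<in> {1..9}" for t :: nat
    using that unfolding ivl insert_iff empty_iff by (elim disjE FalseE; hypsubst; simp add: transpose_def)
qed simp_all

section \<open>Case distinction for two odd primes\<close>

lemma odd_prime_ge_3: "odd p \<Longrightarrow> prime p \<Longrightarrow> 3 \<le> p" for p :: nat
  using prime_ge_2_nat[of p] by (cases "p = 2") auto

lemma odd_prime_mono:
  fixes p q :: nat
  assumes "prime p" "odd p" "prime q" "p \<le> q"
  shows "odd q"
  using odd_prime_ge_3[OF assms(2,1)] assms(3,4) prime_odd_nat[of q] by simp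

text \<open>For \<open>i \<ge> 2\<close> with \<open>i + 1 < q\<close> the indices collide only if
  \<open>i\<close> is one of \<open>m - 1\<close>, \<open>m\<close>, \<open>q - m\<close>,
  \<open>q - m + 1\<close>. For \<open>q \<ge> 9\<close> these two pairs of neighbours cannot cover
  2, 3, 4. For \<open>q = 7\<close> and \<open>m = 3\<close> or \<open>m = 5\<close> they cover all
  of 2, ..., 5.\<close>

lemma exists_shift:
  fixes m q :: nat
  assumes m: "2 \<le> m" "m < q" and q: "9 \<le> q \<or> q = 7 \<and> m \<in> {2, 4, 6}"
  shows "\<exists>i. distinct [0, 1, m, i, i + 1, (m + i) mod q] \<and> i + 1 < q"
proof -
  have "\<exists>i. 2 \<le> i \<and> i + 1 < q \<and> i \<noteq> m \<and> i + 1 \<noteq> m \<and> m + i \<noteq> q \<and> m + i \<noteq> q + 1"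
  proof (cases "q = 7")
    case True
    then consider "m = 2" | "m = 4" | "m = 6" using q by auto
    then show ?thesis
    proof cases
      case 1 then show ?thesis using True by (intro exI[of _ 3]) simp
    next
      case 2 then show ?thesis using True by (intro exI[of _ 2]) simp
    next
      case 3 then show ?thesis using True by (intro exI[of _ 3]) simp
    qed
  next
    case False
    then have "9 \<le> q" using q by blast
    then have "\<exists>i\<in>{2, 3, 4}. i \<noteq> m \<and> i + 1 \<noteq> m \<and> m + i \<noteq> q \<and> m + i \<noteq> q + 1"
      by (simp, presburger)
    then obtain i where "i \<in> {2, 3, 4}" "i \<noteq> m \<and> i + 1 \<noteq> m \<and> m + i \<noteq> q \<and> m + i \<noteq> q + 1" ..
    then show ?thesis using \<open>9 \<le> q\<close> by (intro exI[of _ i]) auto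
  qed
  then obtain i where i: "2 \<le> i" "i + 1 < q" "i \<noteq> m" "i + 1 \<noteq> m" "m + i \<noteq> q" "m + i \<noteq> q + 1"
    by blast
  have "(m + i) mod q = (if m + i < q then m + i else m + i - q)"
    using m(2) i(2) by (simp add: mod_if)
  then have "distinct [0, 1, m, i, i + 1, (m + i) mod q]" using i m by (auto split: if_splits)
  then show ?thesis using i(2) by blast
qed

lemma alt_pair_small_primes:
  assumes pq: "prime p" "prime q" "odd p" "p \<le> q" and n: "5 \<le> n" "q < n" "n < 2 * p" "n < p + q - 1"
    and no: "\<not> (9 \<le> q \<or> q = 7 \<and> p + q - n \<in> {2, 4, 6})"
  shows "\<exists>X Y. alt_pair p q {1..n} X Y"
proof -
  have "odd q" using odd_prime_mono[OF pq(1,3,2,4)] .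
  have q: "q \<noteq> 1" "q \<noteq> 0" using pq(2) by (auto simp: not_prime_1)
  have p1: "p \<noteq> 1" using pq(1) by (auto simp: not_prime_1)
  have "q \<le> 8" using no by simp
  with q \<open>odd q\<close> have "q = 3 \<or> q = 5 \<or> q = 7" by presburger
  moreover have "p \<le> 7" using \<open>q \<le> 8\<close> \<open>odd q\<close> pq(4) by presburger
  with pq(3) p1 have "p = 3 \<or> p = 5 \<or> p = 7" by presburger
  \<comment> \<open>\<open>p = 3\<close> would force \<open>n = 5\<close>, hence
    \<open>q = 3\<close> and \<open>n < 5\<close>. For \<open>p = q = 5\<close> the overlaps 4, 3, 2
    remain, and for \<open>q = 7\<close> the overlaps 3 and 5, the latter only with
    \<open>p = 7\<close>.\<close>
  ultimately have "p = 5 \<and> q = 5 \<and> n = 6 \<or> p = 5 \<and> q = 5 \<and> n = 7 \<or> p = 5 \<and> q = 5 \<and> n = 8 \<or>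
    p = 7 \<and> q = 7 \<and> n = 9 \<or> p = 7 \<and> q = 7 \<and> n = 11 \<or> p = 5 \<and> q = 7 \<and> n = 9"
    using n no pq(4) by (elim disjE; simp; presburger)
  then show ?thesis
    using alt_pair_5_5_6 alt_pair_5_5_7 alt_pair_5_5_8 alt_pair_7_7_9 alt_pair_7_7_11 alt_pair_5_7_9 by (elim disjE conjE) simp_all
qed

text \<open>Two cycles sharing only the point 1 leave \<open>q - 1\<close> and \<open>p - 1\<close>
  free points, which is exactly what \<open>alt_pair_extend\<close> demands.\<close>

lemma alt_pair_odd_disjoint:
  assumes pq: "prime p" "prime q" "odd p" "p \<le> q" and n: "p + q - 1 \<le> n"
  shows "\<exists>X Y. alt_pair p q {1..n} X Y"
proof -
  have p3: "p \<ge> 3" using odd_prime_ge_3[OF pq(3,1)] .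
  have "odd q" using odd_prime_mono[OF pq(1,3,2)] pq(4) by simp
  have q3: "q \<ge> 3" using p3 pq(4) by simp
  define bs where "bs = 1 # 2 # [3..<q + 1]"
  define as where "as = 1 # (q + 1) # [q + 2..<p + q]"
  have sbs: "set bs = {1..q}" using p3 pq(4) by (auto simp: bs_def)
  have sas: "set as = insert 1 {q + 1..<p + q}" using p3 by (auto simp: as_def)
  have S: "set as \<union> set bs = {1..p + q - 1}" unfolding sbs sas using p3 pq(4) by auto
  have len: "length as = p" "length bs = q" using p3 pq(4) by (auto simp: as_def bs_def)
  have dist: "distinct as" "distinct bs" using p3 pq(4) by (auto simp: as_def bs_def)
  have "alt_pair p q (set as \<union> set bs) (set as) (set bs)"
  proof (rule alt_pair_two_cycles[OF pq(1,2,3) \<open>odd q\<close> dist(1) len(1) dist(2) len(2)])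
    show "set as \<inter> set bs \<noteq> {}" by (auto simp: as_def bs_def)
    fix H :: "(nat \<Rightarrow> nat) set"
    assume H: "perm_group H" "cycle_of_list as \<in> H" "cycle_of_list bs \<in> H"
    have "cycle_of_list [1, q + 1, 2] \<in> H"
    proof (rule commutator_one_point[OF H(1)])
      show "distinct (1 # 2 # [3..<q + 1] @ (q + 1) # [q + 2..<p + q])" using p3 pq(4) by auto
    qed (use H as_def bs_def in metis)+
    moreover have "distinct [1, q + 1, 2]" using q3 by simp
    moreover have "{1, q + 1, 2} \<subseteq> {1..p + q - 1}" using p3 q3 by auto
    ultimately show "\<exists>x y z. distinct [x, y, z] \<and> {x, y, z} \<subseteq> set as \<union> set bs \<and> cycle_of_list [x, y, z] \<in> H"
      unfolding S by blast
  qed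
  then have g: "alt_pair p q {1..p + q - 1} (set as) (set bs)" unfolding S .
  have "{1..p + q - 1} - set as = {2..q}" unfolding sas using p3 by auto
  then have c1: "card ({1..p + q - 1} - set as) = q - 1" by simp
  have "{1..p + q - 1} - set bs = {q + 1..p + q - 1}" unfolding sbs using p3 by auto
  then have c2: "card ({1..p + q - 1} - set bs) = p - 1" by simp
  have "\<exists>X' Y'. alt_pair p q ({1..p + q - 1} \<union> {p + q..n}) X' Y'"
    by (rule alt_pair_extend[OF g pq(1,2,4)]) (use c1 c2 in auto)
  moreover have "{1..p + q - 1} \<union> {p + q..n} = {1..n}" using n p3 by auto
  ultimately show ?thesis by simp
qed

text \<open>The \<open>p\<close>-cycle runs through an initial segment of the
  \<open>q\<close>-cycle. For \<open>n > q\<close> a second \<open>p\<close>-cycle takes up the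
  \<open>n - q\<close> new points and completes itself from the \<open>q - p\<close> free ones;
  \<open>2 * p \<le> n\<close> says that there are enough.\<close>

lemma alt_pair_odd_nested:
  assumes pq: "prime p" "prime q" "odd p" "p < q" and n: "q \<le> n" "n < p + q"
    "n = q \<or> 2 * p \<le> n"
  shows "\<exists>X Y. alt_pair p q {1..n} X Y"
proof -
  have p3: "p \<ge> 3" using odd_prime_ge_3[OF pq(3,1)] .
  have "odd q" using odd_prime_mono[OF pq(1,3,2)] pq(4) by simp
  define as where "as = 1 # 2 # [3..<p + 1]"
  define bs where "bs = 1 # 2 # [3..<p + 1] @ (p + 1) # [p + 2..<q + 1]"
  have sbs: "set bs = {1..q}" using p3 pq(4) by (auto simp: bs_def)
  have sas: "set as = {1..p}" using p3 by (auto simp: as_def)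
  have S: "set as \<union> set bs = {1..q}" unfolding sbs sas using pq(4) by auto
  have len: "length as = p" "length bs = q" using p3 pq(4) by (auto simp: as_def bs_def)
  have dist: "distinct as" "distinct bs" using p3 pq(4) by (auto simp: as_def bs_def)
  have "alt_pair p q (set as \<union> set bs) (set as) (set bs)"
  proof (rule alt_pair_two_cycles[OF pq(1,2,3) \<open>odd q\<close> dist(1) len(1) dist(2) len(2)])
    show "set as \<inter> set bs \<noteq> {}" by (auto simp: as_def bs_def)
    fix H :: "(nat \<Rightarrow> nat) set"
    assume H: "perm_group H" "cycle_of_list as \<in> H" "cycle_of_list bs \<in> H"
    have "cycle_of_list [1, 2, p + 1] \<in> H"
      using commutator_prefix[OF H(1), of 1 2 "[3..<p + 1]" "p + 1" "[p + 2..<q + 1]"] H(2,3) dist(2)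
      unfolding as_def bs_def by (simp only:)
    then show "\<exists>x y z. distinct [x, y, z] \<and> {x, y, z} \<subseteq> set as \<union> set bs \<and> cycle_of_list [x, y, z] \<in> H"
      unfolding S using p3 pq(4)
      by (intro exI[of _ 1] exI[of _ 2] exI[of _ "p + 1"]) (simp del: cycle_of_list.simps)
  qed
  then have g: "alt_pair p q {1..q} (set as) (set bs)" unfolding S .
  show ?thesis
  proof (cases "n = q")
    case True then show ?thesis using g by blast
  next
    case False
    have "{1..q} - set as = {p + 1..q}" unfolding sas using p3 by auto
    then have c: "card ({1..q} - set as) = q - p" by simp
    have cE: "card {q + 1..n} = n - q" by simp
    obtain X' where "alt_pair p q ({1..q} \<union> {q + 1..n}) X' (set bs)"
    proof (rule alt_pair_extend1[OF g pq(1), of "{q + 1..n}"])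
      show "p \<le> card {q + 1..n} + card ({1..q} - set as)" unfolding c cE using n False pq(4) by simp
    qed (use n False cE in auto)
    moreover have "{1..q} \<union> {q + 1..n} = {1..n}" using n by auto
    ultimately show ?thesis by auto
  qed
qed

text \<open>Both supports must be everything, so the cycles are chosen to differ by exchanging 1 and
  2; their quotient is then already a 3-cycle.\<close>

lemma alt_pair_odd_equal:
  assumes p: "prime p" "5 \<le> p"
  shows "\<exists>X Y. alt_pair p p {1..p} X Y"
proof -
  have "odd p" using p prime_odd_nat[of p] by simp
  define R where "R = [4..<p + 1]"
  define as where "as = 1 # 2 # 3 # R"
  define bs where "bs = 2 # 1 # 3 # R"
  have S: "set as = {1..p}" "set bs = {1..p}" using p by (auto simp: as_def bs_def R_def)
  have len: "length as = p" "length bs = p" using p by (auto simp: as_def bs_def R_def)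
  have dist: "distinct as" "distinct bs" by (auto simp: as_def bs_def R_def)
  have "alt_pair p p (set as \<union> set bs) (set as) (set bs)"
  proof (rule alt_pair_two_cycles[OF p(1) p(1) \<open>odd p\<close> \<open>odd p\<close> dist(1) len(1) dist(2) len(2)])
    show "set as \<inter> set bs \<noteq> {}" by (auto simp: as_def bs_def)
    fix H :: "(nat \<Rightarrow> nat) set"
    assume H: "perm_group H" "cycle_of_list as \<in> H" "cycle_of_list bs \<in> H"
    have "cycle_of_list [1, 3, 2] \<circ> cycle_of_list bs = cycle_of_list as"
      unfolding as_def bs_def by (auto simp: fun_eq_iff transpose_def)
    then have "cycle_of_list [1, 3, 2] \<in> H"
      using perm_group_quotient[OF H(1) _ H(3)] H(2) by metis
    then show "\<exists>x y z. distinct [x, y, z] \<and> {x, y, z} \<subseteq> set as \<union> set bs \<and> cycle_of_list [x, y, z] \<in> H"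
      unfolding S using p by (intro exI[of _ 1] exI[of _ 3] exI[of _ 2]) (simp del: cycle_of_list.simps)
  qed
  then show ?thesis unfolding S by auto
qed

lemma alt_pair_odd_overlap:
  assumes pq: "prime p" "prime q" "odd p" "p \<le> q" and n: "5 \<le> n" "q < n" "n < 2 * p" "n < p + q - 1"
  shows "\<exists>X Y. alt_pair p q {1..n} X Y"
proof (cases "9 \<le> q \<or> q = 7 \<and> p + q - n \<in> {2, 4, 6}")
  case False
  then show ?thesis by (rule alt_pair_small_primes[OF pq n])
next
  case True
  \<comment> \<open>The forced overlap. The \<open>p\<close>-cycle runs through the first
    \<open>m\<close> entries of the \<open>q\<close>-cycle and then through \<open>q + 1\<close>,
    ..., \<open>n\<close>, which makes \<open>m + (n - q) = p\<close> points.\<close>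
  define m where "m = p + q - n"
  have m: "2 \<le> m" "m < q" using n pq(4) by (auto simp: m_def)
  obtain i where i: "distinct [0, 1, m, i, i + 1, (m + i) mod q]" "i + 1 < q"
    using exists_shift[OF m] True unfolding m_def by blast
  have "odd q" using odd_prime_mono[OF pq(1,3,2,4)] .
  define bs where "bs = [1..<q + 1]"
  define as where "as = take m bs @ (q + 1) # [q + 2..<n + 1]"
  have tk: "take m bs = [1..<m + 1]" using m by (simp add: bs_def take_upt)
  have sbs: "set bs = {1..q}" by (auto simp: bs_def)
  have sas: "set as = {1..m} \<union> {q + 1..n}" using n by (auto simp: as_def tk)
  have S: "set as \<union> set bs = {1..n}" unfolding sbs sas using m n by auto
  have len: "length as = p" "length bs = q" using m n by (auto simp: as_def tk bs_def m_def)
  have dist: "distinct as" "distinct bs" using m by (auto simp: as_def tk bs_def)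
  have "alt_pair p q (set as \<union> set bs) (set as) (set bs)"
  proof (rule alt_pair_two_cycles[OF pq(1,2,3) \<open>odd q\<close> dist(1) len(1) dist(2) len(2)])
    show "set as \<inter> set bs \<noteq> {}" 
    proof -
      have "1 \<in> set as \<inter> set bs" unfolding sas sbs using m by simp
      then show ?thesis by blast
    qed
    fix H :: "(nat \<Rightarrow> nat) set"
    assume H: "perm_group H" "cycle_of_list as \<in> H" "cycle_of_list bs \<in> H"
    have "\<exists>x y z. distinct [x, y, z] \<and> {x, y, z} \<subseteq> set bs \<union> {q + 1} \<and> cycle_of_list [x, y, z] \<in> H"
    proof (rule commutator_interval_three_cycle[OF H(1) dist(2) len(2) _ _ m _ H(3) i])
      show "cycle_of_list (take m bs @ (q + 1) # [q + 2..<n + 1]) \<in> H" using H(2) by (simp only: as_def)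
    qed (use sbs in auto)
    moreover have "set bs \<union> {q + 1} \<subseteq> set as \<union> set bs" unfolding S unfolding sbs using n by auto
    ultimately show "\<exists>x y z. distinct [x, y, z] \<and> {x, y, z} \<subseteq> set as \<union> set bs \<and> cycle_of_list [x, y, z] \<in> H"
      by (meson subset_trans)
  qed
  then show ?thesis unfolding S by blast
qed

lemma alt_pair_odd:
  assumes "5 \<le> n" "prime p" "prime q" "odd p" "p \<le> q" "q \<le> n"
  shows "\<exists>X Y. alt_pair p q {1..n} X Y"
proof (cases "p + q - 1 \<le> n")
  case True
  then show ?thesis using alt_pair_odd_disjoint assms by blast
next
  case False
  show ?thesis
  proof (cases "p < q \<and> (n = q \<or> 2 * p \<le> n)")
    case True
    then show ?thesis using alt_pair_odd_nested[OF assms(2-4)] assms False by simp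
  next
    case nested: False
    show ?thesis
    proof (cases "n = q")
      case True
      then have "p = q" using nested assms by simp
      then show ?thesis using alt_pair_odd_equal assms True by simp
    next
      case neq: False
      \<comment> \<open>If \<open>2 * p \<le> n\<close>, the failure of the nested case leaves
        \<open>p = q\<close>, and then \<open>p + q - 1 \<le> n\<close>.\<close>
      have "n < 2 * p"
      proof (rule ccontr)
        assume "\<not> n < 2 * p"
        then show False using nested False assms by simp
      qed
      then show ?thesis using alt_pair_odd_overlap[OF assms(2-5)] neq False assms(1,6) by simp
    qed
  qed
qed

section \<open>The prime two\<close>

text \<open>The centralizer of (w x)(y z) in the symmetric group on four points, which is dihedral
  of order 8. As a centralizer it is visibly closed under composition.\<close>

definition dihedral :: "'a \<Rightarrow> 'a \<Rightarrow> 'a \<Rightarrow> 'a \<Rightarrow> ('a \<Rightarrow> 'a) set"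
  where "dihedral w x y z = {f. f permutes {w, x, y, z} \<and>
    f \<circ> (transpose w x \<circ> transpose y z) = (transpose w x \<circ> transpose y z) \<circ> f}"

lemma dihedralI:
  assumes "distinct [w, x, y, z]" "f permutes {w, x, y, z}"
    and "f x = (transpose w x \<circ> transpose y z) (f w)" "f w = (transpose w x \<circ> transpose y z) (f x)"
    "f z = (transpose w x \<circ> transpose y z) (f y)" "f y = (transpose w x \<circ> transpose y z) (f z)"
  shows "f \<in> dihedral w x y z"
proof -
  define t where "t = transpose w x \<circ> transpose y z"
  have t: "t w = x" "t x = w" "t y = z" "t z = y" using assms(1) by (auto simp: t_def)
  note f = assms(3-6)[folded t_def]
  have "(f \<circ> t) a = (t \<circ> f) a" for a
  proof (cases "a \<in> {w, x, y, z}")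
    case True
    then have "a = w \<or> a = x \<or> a = y \<or> a = z" by blast
    then show ?thesis using t f by (metis o_apply)
  next
    case False
    then show ?thesis using assms(2) by (auto simp: permutes_not_in t_def)
  qed
  then show ?thesis using assms(2) unfolding dihedral_def t_def by blast
qed

lemma dihedral_mem:
  assumes d: "distinct [w, x, y, z]"
  shows "transpose w x \<in> dihedral w x y z"
    and "transpose w x \<circ> transpose y z \<in> dihedral w x y z"
    and "transpose w y \<circ> transpose x z \<in> dihedral w x y z"
    and "transpose w z \<circ> transpose x y \<in> dihedral w x y z"
proof -
  have t: "transpose a b permutes {w, x, y, z}" if "a \<in> {w, x, y, z}" "b \<in> {w, x, y, z}" for a b
    using that by (rule permutes_swap_id)
  have ne: "w \<noteq> x" "w \<noteq> y" "w \<noteq> z" "x \<noteq> y" "x \<noteq> z" "y \<noteq> z" using d by simp_all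
  show "transpose w x \<in> dihedral w x y z"
    by (rule dihedralI[OF d]) (simp_all add: t ne ne[symmetric])
  show "transpose w x \<circ> transpose y z \<in> dihedral w x y z"
    by (rule dihedralI[OF d]) (simp_all add: t ne ne[symmetric] permutes_compose)
  show "transpose w y \<circ> transpose x z \<in> dihedral w x y z"
    by (rule dihedralI[OF d]) (simp_all add: t ne ne[symmetric] permutes_compose)
  show "transpose w z \<circ> transpose x y \<in> dihedral w x y z"
    by (rule dihedralI[OF d]) (simp_all add: t ne ne[symmetric] permutes_compose)
qed

lemma p_perm_group_dihedral:
  assumes d: "distinct [w, x, y, z]"
  shows "p_perm_group 2 {w, x, y, z} (dihedral w x y z)"
proof (rule p_perm_groupI)
  let ?t = "transpose w x \<circ> transpose y z"
  have ne: "w \<noteq> x" "w \<noteq> y" "w \<noteq> z" "x \<noteq> y" "x \<noteq> z" "y \<noteq> z" using d by simp_all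
  show "id \<in> dihedral w x y z" by (simp add: dihedral_def permutes_id)
  show "f \<circ> g \<in> dihedral w x y z" if "f \<in> dihedral w x y z" "g \<in> dihedral w x y z" for f g
  proof -
    have f: "f permutes {w, x, y, z}" "f \<circ> ?t = ?t \<circ> f"
      and g: "g permutes {w, x, y, z}" "g \<circ> ?t = ?t \<circ> g"
      using that unfolding dihedral_def by blast+
    have "(f \<circ> g) \<circ> ?t = f \<circ> (?t \<circ> g)" unfolding g(2)[symmetric] by (simp only: comp_assoc)
    also have "\<dots> = (f \<circ> ?t) \<circ> g" by (simp only: comp_assoc)
    also have "\<dots> = ?t \<circ> (f \<circ> g)" unfolding f(2) by (simp only: comp_assoc)
    finally show ?thesis using permutes_compose[OF g(1) f(1)] unfolding dihedral_def by blast
  qed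
  show "f a = a" if "f \<in> dihedral w x y z" "a \<notin> {w, x, y, z}" for f a
  proof -
    have "f permutes {w, x, y, z}" using that(1) unfolding dihedral_def by blast
    then show ?thesis using that(2) by (rule permutes_not_in)
  qed
  show "\<exists>k. f ^^ (2 ^ k) = id" if "f \<in> dihedral w x y z" for f
  proof -
    have f: "f permutes {w, x, y, z}" and com: "f \<circ> ?t = ?t \<circ> f"
      using that unfolding dihedral_def by blast+
    have pt: "f (?t a) = ?t (f a)" for a using fun_cong[OF com, of a] by simp
    have fx: "f x = ?t (f w)" using pt[of w] ne by simp
    have fz: "f z = ?t (f y)" using pt[of y] ne by simp
    have inj: "inj f" using f by (rule permutes_inj)
    have fw: "f w = w \<or> f w = x \<or> f w = y \<or> f w = z"
      using permutes_in_image[OF f, of w] by simp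
    have fy: "f y = w \<or> f y = x \<or> f y = y \<or> f y = z"
      using permutes_in_image[OF f, of y] by simp
    have fne: "f y \<noteq> f w" "f y \<noteq> f x" using inj ne by (auto dest: injD)
    \<comment> \<open>Commuting with (w x)(y z) makes \<open>f w\<close> and \<open>f y\<close>
      determine \<open>f\<close>, so the check runs over the possible values of these two.\<close>
    have "(f ^^ 4) a = a" for a
    proof (cases "a \<in> {w, x, y, z}")
      case False
      then have fa: "f a = a" using f by (simp add: permutes_not_in)
      have "(f ^^ k) a = a" for k by (induction k) (simp_all add: fa)
      then show ?thesis .
    next
      case True
      then have "a = w \<or> a = x \<or> a = y \<or> a = z" by blast
      then have "f (f (f (f a))) = a"
        using fw fy fne fx fz ne ne[symmetric] by (elim disjE) simp_all
      then show ?thesis by (simp add: eval_nat_numeral)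
    qed
    then have "f ^^ (2 ^ 2) = id" by (intro ext) simp
    then show ?thesis by blast
  qed
qed simp

lemma double_transposition_comp:
  assumes "distinct [x, y, f, g, h]"
  shows "(transpose x f \<circ> transpose g h) \<circ> (transpose y f \<circ> transpose g h) = cycle_of_list [x, f, y]"
proof
  fix t
  have ne: "x \<noteq> y" "x \<noteq> f" "x \<noteq> g" "x \<noteq> h" "y \<noteq> f" "y \<noteq> g" "y \<noteq> h" "f \<noteq> g" "f \<noteq> h" "g \<noteq> h"
    using assms by simp_all
  have "t = x \<or> t = y \<or> t = f \<or> t = g \<or> t = h \<or> t \<notin> {x, y, f, g, h}" by blast
  then show "((transpose x f \<circ> transpose g h) \<circ> (transpose y f \<circ> transpose g h)) t = cycle_of_list [x, f, y] t"
    by (elim disjE) (simp_all add: ne ne[symmetric])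
qed

text \<open>Multiplying corresponding involutions of the two Klein four-groups cancels the common
  transposition and leaves (x k y) for \<open>k\<close> each of \<open>f\<close>, \<open>g\<close>,
  \<open>h\<close>. These 3-cycles all contain \<open>x\<close> and \<open>y\<close>, so their
  supports fuse.\<close>

lemma klein_groups_full:
  assumes H: "perm_group H" and d: "distinct [x, y, f, g, h]"
    and x: "transpose x f \<circ> transpose g h \<in> H" "transpose x g \<circ> transpose f h \<in> H"
      "transpose x h \<circ> transpose f g \<in> H"
    and y: "transpose y f \<circ> transpose g h \<in> H" "transpose y g \<circ> transpose f h \<in> H"
      "transpose y h \<circ> transpose f g \<in> H"
  shows "full H {x, y, f, g, h}"
proof -
  have T: "full H {x, k, y} \<and> three_points {x, k, y}"
    if "distinct [x, y, k, l, m]" "transpose x k \<circ> transpose l m \<in> H" "transpose y k \<circ> transpose l m \<in> H" for k l m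
  proof -
    have "cycle_of_list [x, k, y] \<in> H"
      using perm_group_comp[OF H that(2,3)] unfolding double_transposition_comp[OF that(1)] .
    moreover have "distinct [x, k, y]" using that(1) by auto
    ultimately show ?thesis using three_cycle_full[OF H] by (auto simp: three_points_def)
  qed
  have f: "full H {x, f, y}" "three_points {x, f, y}" using T[of f g h] x y d by simp_all
  have g: "full H {x, g, y}" "three_points {x, g, y}" using T[of g f h] x y d by auto
  have h: "full H {x, h, y}" "three_points {x, h, y}" using T[of h f g] x y d by auto
  have fg: "full H ({x, f, y} \<union> {x, g, y})" by (rule full_Un[OF H f g]) blast
  have "three_points ({x, f, y} \<union> {x, g, y})" using f(2) unfolding three_points_def by blast
  then have "full H (({x, f, y} \<union> {x, g, y}) \<union> {x, h, y})" by (rule full_Un[OF H fg _ h]) blast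
  then show ?thesis by (rule full_mono) blast
qed

lemma evenperm_double_transposition:
  "a \<noteq> b \<Longrightarrow> c \<noteq> d \<Longrightarrow> evenperm (transpose a b \<circ> transpose c d)"
  by (simp add: evenperm_comp permutation_swap_id evenperm_swap)

lemma dihedral_klein:
  assumes "distinct [x, f, g, h]" "\<And>u. u \<in> dihedral x f g h \<Longrightarrow> evenperm u \<Longrightarrow> u \<in> H"
  shows "transpose x f \<circ> transpose g h \<in> H" "transpose x g \<circ> transpose f h \<in> H"
    "transpose x h \<circ> transpose f g \<in> H"
  using assms(2)[OF dihedral_mem(2)[OF assms(1)]] assms(2)[OF dihedral_mem(3)[OF assms(1)]]
    assms(2)[OF dihedral_mem(4)[OF assms(1)]] assms(1)
  by (simp_all add: evenperm_double_transposition)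

section \<open>Configurations with a 2-group\<close>

lemma alt_pair_2_2:
  fixes n :: nat
  assumes "5 \<le> n"
  shows "\<exists>X Y. alt_pair 2 2 {1..n} X Y"
proof -
  have d: "distinct [1, 2, 3, 4::nat]" "distinct [5, 2, 3, 4::nat]" by simp_all
  have S: "{1, 5, 2, 3, 4} = {1..5::nat}" by (rule Set.set_eqI) (simp, presburger)
  \<comment> \<open>The two Klein four-groups share 2, 3, 4. Each group leaves one free point, just
    enough for \<open>alt_pair_extend\<close> with both primes equal to 2.\<close>
  have g: "alt_pair 2 2 {1..5::nat} {1, 2, 3, 4} {5, 2, 3, 4}"
  proof (rule alt_pairI[OF _ _ _ _ p_perm_group_dihedral[OF d(1)] p_perm_group_dihedral[OF d(2)]])
    show "three_points {1..5::nat}" unfolding S[symmetric] three_points_def by auto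
    show "\<exists>x y. x \<noteq> y \<and> transpose x y \<in> dihedral 1 2 3 (4::nat)"
      using dihedral_mem(1)[OF d(1)] by (intro exI[of _ 1] exI[of _ 2]) simp
    show "\<exists>x y. x \<noteq> y \<and> transpose x y \<in> dihedral 5 2 3 (4::nat)"
      using dihedral_mem(1)[OF d(2)] by (intro exI[of _ 5] exI[of _ 2]) simp
    show "spans (dihedral 1 2 3 4 \<union> dihedral 5 2 3 4) {1..5::nat}"
      unfolding spans_def S[symmetric]
    proof (intro allI impI, elim conjE)
      fix H :: "(nat \<Rightarrow> nat) set"
      assume H: "perm_group H" and ev: "\<forall>f\<in>dihedral 1 2 3 4 \<union> dihedral 5 2 3 4. evenperm f \<longrightarrow> f \<in> H"
      show "full H {1, 5, 2, 3, 4}"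
        using klein_groups_full[OF H, of 1 5 2 3 4] dihedral_klein[OF d(1), of H]
          dihedral_klein[OF d(2), of H] ev by simp
    qed
  qed auto
  have "{1..5} - {1, 2, 3, 4} = {5::nat}" "{1..5} - {5, 2, 3, 4} = {1::nat}"
    unfolding S[symmetric] by auto
  then have "\<exists>X Y. alt_pair 2 2 ({1..5} \<union> {6..n}) X Y"
    by (intro alt_pair_extend[OF g]) auto
  moreover have "{1..5} \<union> {6..n} = {1..n}" using assms by auto
  ultimately show ?thesis by simp
qed

lemma alt_pair_2_3:
  fixes n :: nat
  assumes "5 \<le> n"
  shows "\<exists>X Y. alt_pair 2 3 {1..n} X Y"
proof -
  \<comment> \<open>The 3-cycle (1 2 3) is given from the start. The even element (1 4)(2 5) links 4
    and 5 to it, and (1 4) is the transposition to be kept in the group.\<close>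
  define P :: "(nat \<Rightarrow> nat) set" where "P = {f \<circ> g |f g.
    f \<in> range (\<lambda>i. cycle_of_list [1, 4] ^^ i) \<and> g \<in> range (\<lambda>i. cycle_of_list [2, 5] ^^ i)}"
  define Q :: "(nat \<Rightarrow> nat) set" where "Q = range (\<lambda>i. cycle_of_list [1, 2, 3] ^^ i)"
  have P: "p_perm_group 2 ({1, 4} \<union> {2, 5}) P"
    unfolding P_def
    using p_perm_group_cycle[of "[1, 4::nat]" 2] p_perm_group_cycle[of "[2, 5::nat]" 2]
    by (intro p_perm_group_prod) simp_all
  have Q: "p_perm_group 3 {1, 2, 3} Q"
    unfolding Q_def using p_perm_group_cycle[of "[1, 2, 3::nat]" 3] by simp
  have mem: "(transpose 1 4 :: nat \<Rightarrow> nat) \<circ> transpose 2 5 \<in> P" "(transpose 1 4 :: nat \<Rightarrow> nat) \<in> P"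
  proof -
    have r: "h \<in> range (\<lambda>i. h ^^ i)" "id \<in> range (\<lambda>i. h ^^ i)" for h :: "nat \<Rightarrow> nat"
      by (rule range_eqI[of _ _ 1], simp) (rule range_eqI[of _ _ 0], simp)
    have e: "cycle_of_list [1, 4] = (transpose 1 4 :: nat \<Rightarrow> nat)"
      "cycle_of_list [2, 5] = (transpose 2 5 :: nat \<Rightarrow> nat)" by simp_all
    show "(transpose 1 4 :: nat \<Rightarrow> nat) \<circ> transpose 2 5 \<in> P"
      unfolding P_def e using r(1) by blast
    have "(transpose 1 4 :: nat \<Rightarrow> nat) \<circ> id \<in> P" unfolding P_def e using r by blast
    then show "(transpose 1 4 :: nat \<Rightarrow> nat) \<in> P" by simp
  qed
  have S: "{1, 2, 3, 4, 5} = {1..5::nat}" by (rule Set.set_eqI) (simp, presburger)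
  have g: "alt_pair 2 3 {1..5::nat} ({1, 4} \<union> {2, 5}) {1, 2, 3}"
  proof (rule alt_pairI[OF _ _ _ _ P Q])
    show "three_points {1..5::nat}" unfolding S[symmetric] three_points_def by auto
    show "\<exists>x y. x \<noteq> y \<and> transpose x y \<in> P" using mem(2) by (intro exI[of _ 1] exI[of _ 4]) simp
    show "spans (P \<union> Q) {1..5}"
      unfolding spans_def S[symmetric]
    proof (intro allI impI, elim conjE)
      fix H :: "(nat \<Rightarrow> nat) set"
      assume H: "perm_group H" and ev: "\<forall>f\<in>P \<union> Q. evenperm f \<longrightarrow> f \<in> H"
      have cQ: "cycle_of_list [1, 2, 3] \<in> Q" unfolding Q_def by (rule range_eqI[of _ _ 1]) simp
      then have c: "cycle_of_list [1, 2, 3] \<in> H"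
      proof -
        have "evenperm (cycle_of_list [1, 2, 3 :: nat])"
          by (rule odd_p_perm_group_even[OF Q cQ]) simp_all
        then show ?thesis using ev cQ by blast
      qed
      have d: "(transpose 1 4 :: nat \<Rightarrow> nat) \<circ> transpose 2 5 \<in> H"
        using ev mem(1) evenperm_double_transposition[of 1 4 2 "5::nat"] by simp
      have 1: "full H {1, 2, 3}" using three_cycle_full[OF H c] by simp
      have b: "three_points {1, 2, 3::nat}" "three_points {4, 1, 2, 3::nat}" by (auto simp: three_points_def)
      have 2: "full H {4, 1, 2, 3}"
        using adjoin_point[OF H 1 b(1) d, of 3 1] by simp
      have "full H {5, 4, 1, 2, 3}"
        using adjoin_point[OF H 2 b(2) d, of 3 2] by simp
      then show "full H {1, 2, 3, 4, 5}" by (rule full_mono) blast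
    qed
  qed (auto simp flip: S)
  have c: "card ({1..5} - ({1, 4} \<union> {2, 5::nat})) = 1" "card ({1..5} - {1, 2, 3::nat}) = 2"
  proof -
    have "{1..5} - ({1, 4} \<union> {2, 5}) = {3::nat}" "{1..5} - {1, 2, 3} = {4, 5::nat}"
      unfolding S[symmetric] by auto
    then show "card ({1..5} - ({1, 4} \<union> {2, 5::nat})) = 1" "card ({1..5} - {1, 2, 3::nat}) = 2" by simp_all
  qed
  \<comment> \<open>Only the point 3 is free for the 2-group, one fewer than
    \<open>alt_pair_extend\<close> demands. For \<open>n = 6\<close> the transposition (3 6)
    finishes; for larger \<open>n\<close> a 3-cycle through 6, 7 and one of 4, 5 first raises the
    count to three.\<close>
  consider "n = 5" | "n = 6" | "7 \<le> n" using assms by linarith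
  then show ?thesis
  proof cases
    case 1 then show ?thesis using g by blast
  next
    case 2
    have "\<exists>X. alt_pair 2 3 ({1..5} \<union> {6 :: nat}) X {1, 2, 3}"
      by (rule alt_pair_extend1[OF g, of "{6}"]) (use c in \<open>auto simp del: Un_insert_right\<close>)
    moreover have "{1..5} \<union> {6} = {1..n}" using 2 by auto
    ultimately show ?thesis by auto
  next
    case 3
    have c67: "card {6, 7::nat} = 2" by simp
    obtain Y where Y: "alt_pair 2 3 ({1..5} \<union> {6, 7::nat}) ({1, 4} \<union> {2, 5}) Y"
      "card ({1..5} \<union> {6, 7} - Y) = 1" "card ({1..5} \<union> {6, 7} - ({1, 4} \<union> {2, 5 :: nat})) = 3"
    proof (rule alt_pair_extend2[OF g, of "{6, 7}"])
      fix Y'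
      assume Y': "alt_pair 2 3 ({1..5} \<union> {6, 7::nat}) ({1, 4} \<union> {2, 5}) Y'"
        "card ({1..5} \<union> {6, 7} - Y') = card {6, 7::nat} + card ({1..5} - {1, 2, 3::nat}) - 3"
        "card ({1..5} \<union> {6, 7} - ({1, 4} \<union> {2, 5})) = card ({1..5} - ({1, 4} \<union> {2, 5::nat})) + card {6, 7::nat}"
      show thesis
      proof (rule that[OF Y'(1)])
        show "card ({1..5} \<union> {6, 7} - Y') = 1" unfolding Y'(2) c c67 by simp
        show "card ({1..5} \<union> {6, 7} - ({1, 4} \<union> {2, 5 :: nat})) = 3" unfolding Y'(3) c c67 by simp
      qed
    next
      show "3 \<le> card {6, 7::nat} + card ({1..5} - {1, 2, 3::nat})" unfolding c c67 by simp
    qed auto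
    have "\<exists>X' Y'. alt_pair 2 3 (({1..5} \<union> {6, 7}) \<union> {8..n}) X' Y'"
      by (rule alt_pair_extend[OF Y(1)]; (subst Y(2,3))?) auto
    moreover have "({1..5} \<union> {6, 7}) \<union> {8..n} = {1..n}" using 3 by auto
    ultimately show ?thesis by simp
  qed
qed

text \<open>The bounds on \<open>n\<close> ensure that the \<open>q\<close>-cycle carries the last
  four points to 1 and the last three: it shifts those below \<open>q\<close> by one, sends
  \<open>q\<close> to 1 and fixes those above. Conjugation thus yields a second Klein four-group
  sharing three points with the first.\<close>

lemma alt_pair_2_odd_base:
  assumes q: "prime q" "5 \<le> q" and n: "q \<le> n" "n \<le> q + 3"
  shows "alt_pair 2 q {1..n} {n - 3..n} {1..q}"
proof -
  have "odd q" using q prime_odd_nat[of q] by simp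
  define x f g where xfg: "x = n - 3" "f = n - 2" "g = n - 1"
  have d: "distinct [x, f, g, n]" using q n by (auto simp: xfg)
  have d5: "distinct [x, 1, f, g, n]" using q n by (auto simp: xfg)
  have F: "{n - 3..n} = {x, f, g, n}" using q n by (auto simp: xfg)
  define bs where "bs = [1..<q + 1]"
  have bs: "distinct bs" "length bs = q" "set bs = {1..q}" by (auto simp: bs_def)
  define b where "b = cycle_of_list bs"
  have b1: "b k = k + 1" if "1 \<le> k" "k < q" for k
    using cycle_funpow_nth[OF bs(1), of "k - 1" 1] that bs(2) by (simp add: b_def bs_def del: upt_Suc)
  have bq: "b q = 1"
    using cycle_funpow_nth[OF bs(1), of "q - 1" 1] q(2) bs(2) by (simp add: b_def bs_def del: upt_Suc)
  have bo: "b k = k" if "q < k" for k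
    using that bs(3) by (auto simp: b_def intro!: id_outside_supp)
  have Q: "p_perm_group q {1..q} (range (\<lambda>i. b ^^ i))"
    using p_perm_group_cycle[OF bs(1,2)] q(2) bs(3) by (simp add: b_def)
  show ?thesis
    unfolding F
  proof (rule alt_pairI[OF _ _ _ _ p_perm_group_dihedral[OF d] Q])
    show "three_points {1..n}" unfolding three_points_def
      using q n by (intro bexI[of _ 1] bexI[of _ 2] bexI[of _ 3]) auto
    show "\<exists>x' y'. x' \<noteq> y' \<and> transpose x' y' \<in> dihedral x f g n"
      using dihedral_mem(1)[OF d] d by (intro exI[of _ x] exI[of _ f]) simp
    show "spans (dihedral x f g n \<union> range (\<lambda>i. b ^^ i)) {1..n}"
      unfolding spans_def
    proof (intro allI impI, elim conjE)
      fix H :: "(nat \<Rightarrow> nat) set"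
      assume H: "perm_group H" and ev: "\<forall>u\<in>dihedral x f g n \<union> range (\<lambda>i. b ^^ i). evenperm u \<longrightarrow> u \<in> H"
      have b: "b \<in> range (\<lambda>i. b ^^ i)" by (rule range_eqI[of _ _ 1]) simp
      then have bH: "b \<in> H" using ev odd_p_perm_group_even[OF Q b _ \<open>odd q\<close>] by simp
      have x: "transpose x f \<circ> transpose g n \<in> H" "transpose x g \<circ> transpose f n \<in> H"
        "transpose x n \<circ> transpose f g \<in> H"
        using dihedral_klein[OF d, of H] ev by blast+
      have conj: "transpose (b i) (b j) \<circ> transpose (b k) (b l) \<in> H"
        if "transpose i j \<circ> transpose k l \<in> H" "i \<noteq> j" "k \<noteq> l" for i j k l
      proof -
        have bij: "bij b" using perm_group_bij[OF H bH] .
        have "b \<circ> (transpose i j \<circ> transpose k l) \<circ> inv' b =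
            (b \<circ> transpose i j \<circ> inv' b) \<circ> (b \<circ> transpose k l \<circ> inv' b)"
          using bij by (simp add: fun_eq_iff bij_is_inj)
        also have "\<dots> = transpose (b i) (b j) \<circ> transpose (b k) (b l)"
          using transpose_conj[OF bij] that(2,3) by simp
        finally show ?thesis
          using perm_group_comp[OF H perm_group_comp[OF H bH that(1)] perm_group_inv[OF H bH]] by simp
      qed
      note c = conj[OF x(1)] conj[OF x(2)] conj[OF x(3)]
      have com: "transpose i j \<circ> transpose k l = transpose k l \<circ> transpose i j"
        if "distinct [i, j, k, l]" for i j k l :: nat
        using permutes_disjoint_commute[OF permutes_swap_id permutes_swap_id, of i "{i, j}" j k "{k, l}" l] that
        by auto
      have y: "transpose 1 f \<circ> transpose g n \<in> H \<and> transpose 1 g \<circ> transpose f n \<in> H \<and>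
        transpose 1 n \<circ> transpose f g \<in> H"
      proof -
        \<comment> \<open>Four, three, two or one of the last four points lie on the
          \<open>q\<close>-cycle. The conjugated involutions are the desired ones up to order and
          notation.\<close>
        consider "n = q" | "n = q + 1" | "n = q + 2" | "n = q + 3" using n by linarith
        then show ?thesis
        proof cases
          case 1
          then have "b x = f" "b f = g" "b g = n" "b n = 1" using b1 bq q(2) by (auto simp: xfg)
          then show ?thesis using c d5 com[of f g n 1] com[of f n g 1] com[of f 1 g n]
            by (auto simp: transpose_commute)
        next
          case 2
          then have "b x = f" "b f = g" "b g = 1" "b n = n" using b1 bq bo q(2) by (auto simp: xfg)
          then show ?thesis using c d5 com[of f g 1 n] com[of f 1 g n] com[of f n g 1]
            by (auto simp: transpose_commute)
        next
          case 3
          then have "b x = f" "b f = 1" "b g = g" "b n = n" using b1 bq bo q(2) by (auto simp: xfg)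
          then show ?thesis using c d5 com[of f g 1 n] com[of f 1 g n] com[of f n g 1]
            by (auto simp: transpose_commute)
        next
          case 4
          then have "b x = 1" "b f = f" "b g = g" "b n = n" using bq bo q(2) by (auto simp: xfg)
          then show ?thesis using c d5 by (auto simp: transpose_commute)
        qed
      qed
      have K: "full H {x, 1, f, g, n}" using klein_groups_full[OF H d5 x] y by blast
      have "three_points {x, 1, f, g, n}" using d5 by (auto simp: three_points_def)
      moreover have "set bs \<inter> {x, 1, f, g, n} \<noteq> {}" using bs(3) q(2) by auto
      ultimately have "full H ({x, 1, f, g, n} \<union> set bs)"
        using adjoin_cycle_odd[OF H bs(1) _ _ K] bH q(1) bs(2) unfolding b_def by blast
      moreover have "{1..n} \<subseteq> {x, 1, f, g, n} \<union> set bs"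
        unfolding bs(3) using n by (auto simp: xfg)
      ultimately show "full H {1..n}" by (rule full_mono)
    qed
  qed (use q n in \<open>auto simp: xfg\<close>)
qed

lemma alt_pair_2_odd:
  assumes q: "prime q" "5 \<le> q" and n: "q \<le> n"
  shows "\<exists>X Y. alt_pair 2 q {1..n} X Y"
proof (cases "n \<le> q + 3")
  case True
  then show ?thesis using alt_pair_2_odd_base[OF q n] by blast
next
  case False
  \<comment> \<open>At \<open>n = q + 3\<close> the number of points free for the 2-group,
    \<open>n - 4\<close>, first reaches the \<open>q - 1\<close> that \<open>alt_pair_extend\<close>
    demands.\<close>
  have g: "alt_pair 2 q {1..q + 3} {q..q + 3} {1..q}" using alt_pair_2_odd_base[OF q, of "q + 3"] by simp
  have "{1..q + 3} - {q..q + 3} = {1..q - 1}" "{1..q + 3} - {1..q} = {q + 1..q + 3}" using q by auto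
  then have c: "card ({1..q + 3} - {q..q + 3}) = q - 1" "card ({1..q + 3} - {1..q}) = 3" by simp_all
  have "\<exists>X Y. alt_pair 2 q ({1..q + 3} \<union> {q + 4..n}) X Y"
    by (rule alt_pair_extend[OF g _ q(1)]) (use c q in auto)
  moreover have "{1..q + 3} \<union> {q + 4..n} = {1..n}" using False by auto
  ultimately show ?thesis by simp
qed

theorem theorem6p1:
  fixes n p q :: nat
  assumes "5 \<le> n"
    and "prime p" and "prime q"
    and "p \<le> q" and "q \<le> n"
  shows "\<exists>P Q. sylow_subgroup p P (alt_group n) \<and> sylow_subgroup q Q (alt_group n) \<and>
    generate (alt_group n) (P \<union> Q) = carrier (alt_group n)"
proof -
  have "\<exists>X Y. alt_pair p q {1..n} X Y"
  proof (cases "odd p")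
    case True
    then show ?thesis using alt_pair_odd assms by blast
  next
    case False
    then have p: "p = 2" using assms(2) primes_dvd_imp_eq two_is_prime_nat by blast
    have "q \<noteq> 4"
    proof
      assume "q = 4"
      then have "(2::nat) dvd q" by simp
      then show False using \<open>q = 4\<close> assms(3) primes_dvd_imp_eq[of 2 q] by simp
    qed
    then consider "q = 2" | "q = 3" | "5 \<le> q" using assms(4) p by linarith
    then show ?thesis
      using alt_pair_2_2[OF assms(1)] alt_pair_2_3[OF assms(1)] alt_pair_2_odd[OF assms(3) _ assms(5)] p
      by cases simp_all
  qed
  then show ?thesis using alt_pair_sylow_generate[OF _ assms(2,3)] assms(1) by auto
qed

end
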